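(* Let $G$ be a profinite group, let $(A,B,C)$ be a Tate product over $G$, and let $r,s\ge 0$ be integers. Then for every $\alpha''\in H^r(G,A'')$ and $\beta''\in H^s(G,B'')$ one has $$\alpha''\cup_{\mathrm{aug}}\beta''=(-1)^{rs}\,\beta''\cup_{\mathrm{aug}}\alpha''\quad\text{in } H^{r+s+1}(G,C),$$ where the product on the left is the augmented cup product of $(A,B,C)$ and the product on the right is the augmented cup product of the flipped Tate product $(B,A,C)$.
   Context: For a discrete $G$-module $A$, $C^r(G,A)$ is the group of continuous maps $G^r\to A$, with coboundary $d_rf(x_1,\ldots,x_{r+1})=x_1 f(x_2,\ldots,x_{r+1})+\sum_{i=1}^r(-1)^i f(x_1,\ldots,x_ix_{i+1},\ldots,x_{r+1})+(-1)^{r+1}f(x_1,\ldots,x_r)$; $Z^r=\ker d_r$, $B^r=\operatorname{im} d_{r-1}$, $H^r=Z^r/B^r$. A map $A\times B\to C$, $(a,b)\mapsto a\times b$, of discrete $G$-modules is $G$-bilinear if it is bilinear and $g(a\times b)=ga\times gb$. It induces the cup product $\cup:C^r(G,A)\times C^s(G,B)\to C^{r+s}(G,C)$, $(f\cup g)(x_1,\ldots,x_{r+s})=f(x_1,\ldots,x_r)\times x_1\cdots x_r\, g(x_{r+1},\ldots,x_{r+s})$. A Tate product $(A,B,C)$ over $G$ consists of two short exact sequences of discrete $G$-modules $0\to A'\xrightarrow{i}A\xrightarrow{j}A''\to0$ and $0\to B'\xrightarrow{i}B\xrightarrow{j}B''\to0$, a discrete $G$-module $C$, and two $G$-bilinear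 maps $A'\times B\to C$ and $A\times B'\to C$ that coincide on $A'\times B'$. One identifies $C^r(G,A')$ with $\ker(j_*:C^r(G,A)\to C^r(G,A''))$, and similarly for $B'$. Augmented cup product $\cup_{\mathrm{aug}}:H^r(G,A'')\times H^s(G,B'')\to H^{r+s+1}(G,C)$: given $\alpha'',\beta''$, choose $f\in C^r(G,A)$, $g\in C^s(G,B)$ with $j_*f,j_*g$ cocycles representing $\alpha'',\beta''$; then $d_rf\in C^{r+1}(G,A')$, $d_sg\in C^{s+1}(G,B')$, and $\alpha''\cup_{\mathrm{aug}}\beta''=[d_rf\cup g+(-1)^rf\cup d_sg]$ (well defined). Flipped Tate product $(B,A,C)$: the same two exact sequences in the opposite order, with bilinear maps $B'\times A\to C$, $(b',a)\mapsto a\times b'$, and $B\times A'\to C$, $(b,a')\mapsto a'\times b$. *)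

theory Defs
  imports "HOL-Analysis.Abstract_Topological_Spaces" "HOL-Analysis.Function_Topology" "HOL-Algebra.Coset"
begin

text \<open>A profinite group is a compact, Hausdorff, totally disconnected topological group.\<close>

locale profinite_group = group G
  for G :: "('g, 'm) monoid_scheme" (structure) and T :: "'g topology" +
  assumes topspace_eq: "topspace T = carrier G"
    and continuous_mult: "continuous_map (prod_topology T T) T (\<lambda>(x, y). x \<otimes> y)"
    and continuous_inv: "continuous_map T T (\<lambda>x. inv x)"
    and compact: "compact_space T"
    and Hausdorff: "Hausdorff_space T"
    and totally_disconnected: "connectedin T S \<Longrightarrow> \<exists>a. S \<subseteq> {a}"

text \<open>The group \<open>G\<close> is written multiplicatively on a carrier set, while the coefficient
  modules are additive groups given by types of class \<open>ab_group_add\<close>.\<close>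

locale discrete_module = group G
  for G :: "('g, 'm) monoid_scheme" (structure) and T :: "'g topology"
    and act :: "'g \<Rightarrow> 'a::ab_group_add \<Rightarrow> 'a" +
  assumes act_add: "x \<in> carrier G \<Longrightarrow> act x (a + b) = act x a + act x b"
    and act_one: "act \<one> a = a"
    and act_mult: "x \<in> carrier G \<Longrightarrow> y \<in> carrier G \<Longrightarrow> act (x \<otimes> y) a = act x (act y a)"
    and act_continuous:
      "continuous_map (prod_topology T (discrete_topology UNIV)) (discrete_topology UNIV)
         (\<lambda>(x, a). act x a)"

text \<open>An \<open>r\<close>-tuple \<open>(x\<^sub>1, \<dots>, x\<^sub>r)\<close> is a function on \<open>{..<r}\<close>, with \<open>x\<^sub>i\<close> stored at index \<open>i - 1\<close>;
  the points of the product topology are extensional functions. A cochain is made a total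
  function by letting it vanish off the set of \<open>r\<close>-tuples.\<close>

definition tuples :: "('g, 'm) monoid_scheme \<Rightarrow> nat \<Rightarrow> (nat \<Rightarrow> 'g) set" where
  "tuples G r = (\<Pi>\<^sub>E i\<in>{..<r}. carrier G)"

definition cochains ::
  "('g, 'm) monoid_scheme \<Rightarrow> 'g topology \<Rightarrow> nat \<Rightarrow> ((nat \<Rightarrow> 'g) \<Rightarrow> 'a::ab_group_add) set" where
  "cochains G T r =
     {f. continuous_map (product_topology (\<lambda>_. T) {..<r}) (discrete_topology UNIV) f
         \<and> (\<forall>x. x \<notin> tuples G r \<longrightarrow> f x = 0)}"

definition cochain_group ::
  "('g, 'm) monoid_scheme \<Rightarrow> 'g topology \<Rightarrow> nat \<Rightarrow> ((nat \<Rightarrow> 'g) \<Rightarrow> 'a::ab_group_add) monoid" where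
  "cochain_group G T r =
     \<lparr>carrier = cochains G T r, mult = (\<lambda>f g x. f x + g x), one = (\<lambda>_. 0)\<rparr>"

text \<open>\<open>signed n a\<close> is \<open>(-1)\<^sup>n a\<close>.\<close>

definition signed :: "nat \<Rightarrow> 'a::ab_group_add \<Rightarrow> 'a" where
  "signed n a = (if even n then a else - a)"

text \<open>\<open>merge G r i\<close> sends \<open>(x\<^sub>1, \<dots>, x\<^sub>r\<^sub>+\<^sub>1)\<close> to the \<open>r\<close>-tuple
  \<open>(x\<^sub>1, \<dots>, x\<^sub>i x\<^sub>i\<^sub>+\<^sub>1, \<dots>, x\<^sub>r\<^sub>+\<^sub>1)\<close>, for \<open>1 \<le> i \<le> r\<close>.\<close>

definition merge :: "('g, 'm) monoid_scheme \<Rightarrow> nat \<Rightarrow> nat \<Rightarrow> (nat \<Rightarrow> 'g) \<Rightarrow> (nat \<Rightarrow> 'g)" where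
  "merge G r i x = (\<lambda>j\<in>{..<r}. if Suc j < i then x j
                               else if Suc j = i then x j \<otimes>\<^bsub>G\<^esub> x (Suc j)
                               else x (Suc j))"

definition coboundary ::
  "('g, 'm) monoid_scheme \<Rightarrow> ('g \<Rightarrow> 'a \<Rightarrow> 'a) \<Rightarrow> nat
     \<Rightarrow> ((nat \<Rightarrow> 'g) \<Rightarrow> 'a::ab_group_add) \<Rightarrow> ((nat \<Rightarrow> 'g) \<Rightarrow> 'a)" where
  "coboundary G act r f x =
     (if x \<in> tuples G (Suc r)
      then act (x 0) (f (\<lambda>j\<in>{..<r}. x (Suc j)))
           + (\<Sum>i = 1..r. signed i (f (merge G r i x)))
           + signed (Suc r) (f (restrict x {..<r}))
      else 0)"

definition cocycles ::
  "('g, 'm) monoid_scheme \<Rightarrow> 'g topology \<Rightarrow> ('g \<Rightarrow> 'a \<Rightarrow> 'a) \<Rightarrow> nat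
     \<Rightarrow> ((nat \<Rightarrow> 'g) \<Rightarrow> 'a::ab_group_add) set" where
  "cocycles G T act r =
     kernel (cochain_group G T r) (cochain_group G T (Suc r)) (coboundary G act r)"

definition coboundaries ::
  "('g, 'm) monoid_scheme \<Rightarrow> 'g topology \<Rightarrow> ('g \<Rightarrow> 'a \<Rightarrow> 'a) \<Rightarrow> nat
     \<Rightarrow> ((nat \<Rightarrow> 'g) \<Rightarrow> 'a::ab_group_add) set" where
  "coboundaries G T act r =
     (case r of 0 \<Rightarrow> {\<lambda>_. 0} | Suc q \<Rightarrow> coboundary G act q ` cochains G T q)"

definition cohomology ::
  "('g, 'm) monoid_scheme \<Rightarrow> 'g topology \<Rightarrow> ('g \<Rightarrow> 'a \<Rightarrow> 'a) \<Rightarrow> nat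
     \<Rightarrow> ((nat \<Rightarrow> 'g) \<Rightarrow> 'a::ab_group_add) set monoid" where
  "cohomology G T act r =
     (cochain_group G T r)\<lparr>carrier := cocycles G T act r\<rparr> Mod coboundaries G T act r"

definition cohomology_class ::
  "('g, 'm) monoid_scheme \<Rightarrow> 'g topology \<Rightarrow> ('g \<Rightarrow> 'a \<Rightarrow> 'a) \<Rightarrow> nat
     \<Rightarrow> ((nat \<Rightarrow> 'g) \<Rightarrow> 'a::ab_group_add) \<Rightarrow> ((nat \<Rightarrow> 'g) \<Rightarrow> 'a) set" where
  "cohomology_class G T act r f = coboundaries G T act r #>\<^bsub>cochain_group G T r\<^esub> f"

definition tuple_prod :: "('g, 'm) monoid_scheme \<Rightarrow> nat \<Rightarrow> (nat \<Rightarrow> 'g) \<Rightarrow> 'g" where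
  "tuple_prod G r x = foldr (\<lambda>y z. y \<otimes>\<^bsub>G\<^esub> z) (map x [0..<r]) \<one>\<^bsub>G\<^esub>"

text \<open>Here \<open>act\<close> is the action on the module of the second factor.\<close>

definition cup ::
  "('g, 'm) monoid_scheme \<Rightarrow> ('g \<Rightarrow> 'b \<Rightarrow> 'b) \<Rightarrow> ('a \<Rightarrow> 'b \<Rightarrow> 'c) \<Rightarrow> nat \<Rightarrow> nat
     \<Rightarrow> ((nat \<Rightarrow> 'g) \<Rightarrow> 'a) \<Rightarrow> ((nat \<Rightarrow> 'g) \<Rightarrow> 'b) \<Rightarrow> ((nat \<Rightarrow> 'g) \<Rightarrow> 'c::ab_group_add)" where
  "cup G act pair r s f g x =
     (if x \<in> tuples G (r + s)
      then pair (f (restrict x {..<r})) (act (tuple_prod G r x) (g (\<lambda>j\<in>{..<s}. x (r + j))))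
      else 0)"

locale short_exact_sequence =
  sub: discrete_module G T act' + mid: discrete_module G T act + quot: discrete_module G T act''
  for G :: "('g, 'm) monoid_scheme" (structure) and T :: "'g topology"
    and act' :: "'g \<Rightarrow> 'a1::ab_group_add \<Rightarrow> 'a1"
    and act :: "'g \<Rightarrow> 'a::ab_group_add \<Rightarrow> 'a"
    and act'' :: "'g \<Rightarrow> 'a2::ab_group_add \<Rightarrow> 'a2"
    and i :: "'a1 \<Rightarrow> 'a" and j :: "'a \<Rightarrow> 'a2" +
  assumes i_add: "i (a + b) = i a + i b"
    and i_act: "x \<in> carrier G \<Longrightarrow> i (act' x a) = act x (i a)"
    and j_add: "j (u + v) = j u + j v"
    and j_act: "x \<in> carrier G \<Longrightarrow> j (act x u) = act'' x (j u)"
    and i_inj: "inj i"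
    and exact: "range i = {u. j u = 0}"
    and j_surj: "surj j"

locale G_bilinear =
  left: discrete_module G T actA + right: discrete_module G T actB + target: discrete_module G T actC
  for G :: "('g, 'm) monoid_scheme" (structure) and T :: "'g topology"
    and actA :: "'g \<Rightarrow> 'a::ab_group_add \<Rightarrow> 'a"
    and actB :: "'g \<Rightarrow> 'b::ab_group_add \<Rightarrow> 'b"
    and actC :: "'g \<Rightarrow> 'c::ab_group_add \<Rightarrow> 'c"
    and pair :: "'a \<Rightarrow> 'b \<Rightarrow> 'c" +
  assumes add_left: "pair (a + a') b = pair a b + pair a' b"
    and add_right: "pair a (b + b') = pair a b + pair a b'"
    and equivariant: "x \<in> carrier G \<Longrightarrow> actC x (pair a b) = pair (actA x a) (actB x b)"

text \<open>The data of a Tate product: the three modules of each of the two exact sequences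
  (given by their actions), the maps between them, the module \<open>C\<close>, and the pairings
  \<open>pairA' : A' \<times> B \<rightarrow> C\<close> and \<open>pairB' : A \<times> B' \<rightarrow> C\<close>.\<close>

record ('g, 'a1, 'a, 'a2, 'b1, 'b, 'b2, 'c) tate_data =
  actA' :: "'g \<Rightarrow> 'a1 \<Rightarrow> 'a1"
  actA :: "'g \<Rightarrow> 'a \<Rightarrow> 'a"
  actA'' :: "'g \<Rightarrow> 'a2 \<Rightarrow> 'a2"
  iA :: "'a1 \<Rightarrow> 'a"
  jA :: "'a \<Rightarrow> 'a2"
  actB' :: "'g \<Rightarrow> 'b1 \<Rightarrow> 'b1"
  actB :: "'g \<Rightarrow> 'b \<Rightarrow> 'b"
  actB'' :: "'g \<Rightarrow> 'b2 \<Rightarrow> 'b2"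
  iB :: "'b1 \<Rightarrow> 'b"
  jB :: "'b \<Rightarrow> 'b2"
  actC :: "'g \<Rightarrow> 'c \<Rightarrow> 'c"
  pairA' :: "'a1 \<Rightarrow> 'b \<Rightarrow> 'c"
  pairB' :: "'a \<Rightarrow> 'b1 \<Rightarrow> 'c"

locale tate_product =
  sesA: short_exact_sequence G T "actA' P" "actA P" "actA'' P" "iA P" "jA P" +
  sesB: short_exact_sequence G T "actB' P" "actB P" "actB'' P" "iB P" "jB P" +
  modC: discrete_module G T "actC P" +
  bilA': G_bilinear G T "actA' P" "actB P" "actC P" "pairA' P" +
  bilB': G_bilinear G T "actA P" "actB' P" "actC P" "pairB' P"
  for G :: "('g, 'm) monoid_scheme" (structure) and T :: "'g topology"
    and P :: "('g, 'a1::ab_group_add, 'a::ab_group_add, 'a2::ab_group_add,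
               'b1::ab_group_add, 'b::ab_group_add, 'b2::ab_group_add, 'c::ab_group_add) tate_data" +
  assumes pairs_coincide: "pairA' P a' (iB P b') = pairB' P (iA P a') b'"

definition flip ::
  "('g, 'a1, 'a, 'a2, 'b1, 'b, 'b2, 'c) tate_data
     \<Rightarrow> ('g, 'b1, 'b, 'b2, 'a1, 'a, 'a2, 'c) tate_data" where
  "flip P =
     \<lparr>actA' = actB' P, actA = actB P, actA'' = actB'' P, iA = iB P, jA = jB P,
      actB' = actA' P, actB = actA P, actB'' = actA'' P, iB = iA P, jB = jA P,
      actC = actC P,
      pairA' = (\<lambda>b' a. pairB' P a b'),
      pairB' = (\<lambda>b a'. pairA' P a' b)\<rparr>"

text \<open>The cochain \<open>d f \<union> g + (-1)\<^sup>r f \<union> d g\<close>. The identification of \<open>C(G, A')\<close> with the kernel of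
  \<open>j\<^sub>*\<close> on \<open>C(G, A)\<close> is made explicit by composing with the partial inverse of \<open>i\<close>, so the
  definition is meaningful only if \<open>d f\<close> and \<open>d g\<close> take values in the images of \<open>A'\<close> and \<open>B'\<close>.\<close>

definition aug_cochain ::
  "('g, 'm) monoid_scheme
     \<Rightarrow> ('g, 'a1, 'a::ab_group_add, 'a2, 'b1, 'b::ab_group_add, 'b2, 'c::ab_group_add) tate_data
     \<Rightarrow> nat \<Rightarrow> nat \<Rightarrow> ((nat \<Rightarrow> 'g) \<Rightarrow> 'a) \<Rightarrow> ((nat \<Rightarrow> 'g) \<Rightarrow> 'b) \<Rightarrow> ((nat \<Rightarrow> 'g) \<Rightarrow> 'c)" where
  "aug_cochain G P r s f g x =
     cup G (actB P) (pairA' P) (Suc r) s (the_inv (iA P) \<circ> coboundary G (actA P) r f) g x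
     + signed r
        (cup G (actB' P) (pairB' P) r (Suc s) f (the_inv (iB P) \<circ> coboundary G (actB P) s g) x)"

definition aug_cup ::
  "('g, 'm) monoid_scheme \<Rightarrow> 'g topology
     \<Rightarrow> ('g, 'a1, 'a::ab_group_add, 'a2::ab_group_add, 'b1, 'b::ab_group_add, 'b2::ab_group_add,
         'c::ab_group_add) tate_data
     \<Rightarrow> nat \<Rightarrow> nat \<Rightarrow> ((nat \<Rightarrow> 'g) \<Rightarrow> 'a2) set \<Rightarrow> ((nat \<Rightarrow> 'g) \<Rightarrow> 'b2) set
     \<Rightarrow> ((nat \<Rightarrow> 'g) \<Rightarrow> 'c) set" where
  "aug_cup G T P r s \<alpha> \<beta> =
     (THE \<gamma>. \<exists>f g. f \<in> cochains G T r \<and> g \<in> cochains G T s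
        \<and> jA P \<circ> f \<in> cocycles G T (actA'' P) r \<and> cohomology_class G T (actA'' P) r (jA P \<circ> f) = \<alpha>
        \<and> jB P \<circ> g \<in> cocycles G T (actB'' P) s \<and> cohomology_class G T (actB'' P) s (jB P \<circ> g) = \<beta>
        \<and> \<gamma> = cohomology_class G T (actC P) (r + s + 1) (aug_cochain G P r s f g))"

end

(* Write an r-cochain f homogeneously as F(s_0, ..., s_r) = s_0 f(s_0^-1 s_1, ..., s_(r-1)^-1 s_r).
   Reversing the vertices, (Tf)(s_0, ..., s_r) = (-1)^(r(r+1)/2) F(s_r, ..., s_0), is a chain map. It is
   homotopic to the identity by an explicit equivariant homotopy built from the vertices only, so it
   preserves continuity and acts as the identity on cohomology. It satisfies
   T(f \<union> g) = (-1)^(rs) Tg \<union> Tf for the opposite pairing. Hence T turns the cochain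
   df \<union> g + (-1)^r f \<union> dg exactly into (-1)^(rs) times the same cochain for Tg and Tf in the
   flipped product, which proves the formula on classes. Independence of the choice of f follows from
   the Leibniz rule, and that of g by applying T and flipping. *)
theory Submission
  imports Defs
begin

text \<open>No pairing of A with B is given, so f \<union> g makes no sense for the lifts themselves
  and graded commutativity of a cup product on A and B cannot be invoked. An identity between
  cochains is needed instead, and reversal supplies it, because it treats each of the two summands
  with its own pairing. The exponent r(r+1)/2 is dictated by compatibility with d: reversing n
  vertices exchanges face i with face n-1-i and so costs (-1)^(n-1), which must be the quotient of
  the signs in consecutive degrees. Its failure to be additive in the degree, (r+s)(r+s+1)/2 -
  r(r+1)/2 - s(s+1)/2 = rs, is the origin of the sign in the formula. A contraction towards a fixed
  base point would destroy equivariance of the homotopy; the cone vertex is therefore taken from the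
  argument itself. Writing simplices as lists of vertices lets all these identities be proved by
  list induction, and the group enters only in the comparison with inhomogeneous cochains.\<close>

section \<open>Signs and additive maps\<close>

lemma signed_0 [simp]: "signed 0 a = a" "signed n (0::'a::ab_group_add) = 0"
  by (simp_all add: signed_def)

lemma signed_Suc [simp]: "signed (Suc n) a = - signed n a"
  by (simp add: signed_def)

lemma signed_add: "signed n (a + b) = signed n a + signed n b"
  by (simp add: signed_def)

lemma signed_diff: "signed n (a - b) = signed n a - signed n b"
  by (simp add: signed_def)

lemma signed_signed: "signed m (signed n a) = signed (m + n) a"
  by (simp add: signed_def)

lemma additive_diff:
  fixes \<theta> :: "'a::ab_group_add \<Rightarrow> 'b::ab_group_add"
  assumes "\<And>a b. \<theta> (a + b) = \<theta> a + \<theta> b"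
  shows "\<theta> (a - b) = \<theta> a - \<theta> b"
  using assms[of "a - b" b] by (simp add: algebra_simps)

text \<open>Compatibility with subtraction is the form of additivity used from here on: the
  recursion for \<open>simplicial_diff\<close> only subtracts, and zero, negation and signs follow
  from this single hypothesis.\<close>

lemma diff_additive_0:
  fixes \<theta> :: "'a::ab_group_add \<Rightarrow> 'b::ab_group_add"
  assumes "\<And>a b. \<theta> (a - b) = \<theta> a - \<theta> b"
  shows "\<theta> 0 = 0"
  using assms[of 0 0] by simp

lemma diff_additive_uminus:
  fixes \<theta> :: "'a::ab_group_add \<Rightarrow> 'b::ab_group_add"
  assumes "\<And>a b. \<theta> (a - b) = \<theta> a - \<theta> b"
  shows "\<theta> (- a) = - \<theta> a"
  using assms[of 0 a] diff_additive_0[of \<theta>, OF assms] by simp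

lemma diff_additive_signed:
  fixes \<theta> :: "'a::ab_group_add \<Rightarrow> 'b::ab_group_add"
  assumes "\<And>a b. \<theta> (a - b) = \<theta> a - \<theta> b"
  shows "\<theta> (signed n a) = signed n (\<theta> a)"
  using diff_additive_uminus[of \<theta>, OF assms] by (simp add: signed_def)

section \<open>Homogeneous cochains as functions of the list of vertices\<close>

text \<open>This is the alternating sum over the faces of a simplex. The recursion splits off the
  face opposite the first vertex and treats the others as faces of the tail with the head frozen, so
  identities follow by induction with \<open>F\<close> generalized and without double sums.\<close>

fun simplicial_diff :: "('g list \<Rightarrow> 'a::ab_group_add) \<Rightarrow> 'g list \<Rightarrow> 'a" where
  "simplicial_diff F [] = 0"
| "simplicial_diff F (a # \<sigma>) = F \<sigma> - simplicial_diff (\<lambda>\<tau>. F (a # \<tau>)) \<sigma>"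

text \<open>One statement covers several uses: translation of vertices against the action of a group
  element, pairing with a fixed element, and plain congruence. The set \<open>C\<close> is there
  because the hypotheses on \<open>F\<close> are available only for vertices in the carrier of the
  group.\<close>

lemma simplicial_diff_map:
  assumes "\<And>a b. \<theta> (a - b) = \<theta> a - \<theta> b"
    and "\<sigma> \<in> lists C"
    and "\<And>\<tau>. \<tau> \<in> lists C \<Longrightarrow> Suc (length \<tau>) = length \<sigma> \<Longrightarrow> F (map \<phi> \<tau>) = \<theta> (F' \<tau>)"
  shows "simplicial_diff F (map \<phi> \<sigma>) = \<theta> (simplicial_diff F' \<sigma>)"
  using assms(2,3)
proof (induction \<sigma> arbitrary: F F' rule: list.induct)
  case Nil
  then show ?case using diff_additive_0[of \<theta>, OF assms(1)] by simp
next
  case (Cons a \<sigma>)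
  have "simplicial_diff (\<lambda>\<tau>. F (\<phi> a # \<tau>)) (map \<phi> \<sigma>) = \<theta> (simplicial_diff (\<lambda>\<tau>. F' (a # \<tau>)) \<sigma>)"
  proof (rule Cons.IH)
    fix \<tau> assume "\<tau> \<in> lists C" "Suc (length \<tau>) = length \<sigma>"
    then show "F (\<phi> a # map \<phi> \<tau>) = \<theta> (F' (a # \<tau>))"
      using Cons.prems(1) Cons.prems(2)[of "a # \<tau>"] by simp
  qed (use Cons.prems in auto)
  then show ?case using Cons.prems by (simp add: assms(1))
qed

lemma simplicial_diff_cong:
  assumes "\<sigma> \<in> lists C"
    and "\<And>\<tau>. \<tau> \<in> lists C \<Longrightarrow> Suc (length \<tau>) = length \<sigma> \<Longrightarrow> F \<tau> = F' \<tau>"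
  shows "simplicial_diff F \<sigma> = simplicial_diff F' \<sigma>"
  using simplicial_diff_map[of "\<lambda>a. a" \<sigma> C F "\<lambda>a. a" F'] assms by simp

lemma simplicial_diff_zero [simp]: "simplicial_diff (\<lambda>_. 0) \<sigma> = 0"
  by (induction \<sigma>) auto

lemma simplicial_diff_minus:
  "simplicial_diff (\<lambda>\<tau>. F \<tau> - F' \<tau>) \<sigma> = simplicial_diff F \<sigma> - simplicial_diff F' \<sigma>"
  by (induction \<sigma> arbitrary: F F') (auto simp: algebra_simps)

lemma simplicial_diff_signed:
  "simplicial_diff (\<lambda>\<tau>. signed n (F \<tau>)) \<sigma> = signed n (simplicial_diff F \<sigma>)"
  by (induction \<sigma> arbitrary: F) (auto simp: signed_diff)

text \<open>With the head \<open>a\<close> frozen, the inner differential is \<open>F\<close> minus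
  the differential of \<open>F (a # _)\<close>. The two copies of
  \<open>simplicial_diff F \<sigma>\<close> cancel, and what remains is the double differential of
  \<open>F (a # _)\<close>.\<close>

lemma simplicial_diff_diff [simp]: "simplicial_diff (simplicial_diff F) \<sigma> = 0"
  by (induction \<sigma> arbitrary: F) (auto simp: simplicial_diff_minus)

text \<open>The closed form serves to match the summands of the inhomogeneous coboundary.\<close>

lemma simplicial_diff_eq_sum:
  "simplicial_diff F \<sigma> = (\<Sum>i<length \<sigma>. signed i (F (take i \<sigma> @ drop (Suc i) \<sigma>)))"
  by (induction \<sigma> arbitrary: F) (auto simp: sum.lessThan_Suc_shift sum_negf simp del: sum.lessThan_Suc)

lemma simplicial_diff_snoc:
  "simplicial_diff F (\<sigma> @ [a]) = simplicial_diff (\<lambda>\<tau>. F (\<tau> @ [a])) \<sigma> + signed (length \<sigma>) (F \<sigma>)"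
  by (induction \<sigma> arbitrary: F) (auto simp: algebra_simps)

text \<open>For n vertices, face i of the list is face n-1-i of its reverse, and the two signs
  differ by the parity of n-1 - 2i, that is of n-1.\<close>

lemma simplicial_diff_rev:
  "simplicial_diff (\<lambda>\<tau>. F (rev \<tau>)) \<sigma> = signed (length \<sigma> - 1) (simplicial_diff F (rev \<sigma>))"
proof (induction \<sigma> arbitrary: F)
  case (Cons a \<sigma>)
  have "simplicial_diff (\<lambda>\<tau>. F (rev (a # \<tau>))) \<sigma> =
      signed (length \<sigma> - 1) (simplicial_diff (\<lambda>\<tau>. F (\<tau> @ [a])) (rev \<sigma>))"
    using Cons[of "\<lambda>\<tau>. F (\<tau> @ [a])"] by simp
  \<comment> \<open>For empty \<open>\<sigma>\<close> both sides vanish, so the truncated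
    subtraction is harmless.\<close>
  moreover have "signed (length \<sigma>) (simplicial_diff F' (rev \<sigma>)) =
      - signed (length \<sigma> - 1) (simplicial_diff F' (rev \<sigma>))" for F'
    by (cases \<sigma>) auto
  ultimately show ?case
    by (simp add: simplicial_diff_snoc signed_add signed_signed) (simp add: signed_def)
qed simp

section \<open>The signed reversal of vertices and its homotopy to the identity\<close>

text \<open>On n = r+1 vertices the exponent is 0 + ... + (n-1) = r(r+1)/2, written as a sum so that
  passing to one more vertex adds exactly the n needed to absorb the sign of
  \<open>simplicial_diff_rev\<close>.\<close>

definition reversal :: "('g list \<Rightarrow> 'a::ab_group_add) \<Rightarrow> 'g list \<Rightarrow> 'a" where
  "reversal F \<sigma> = signed (\<Sum>{..<length \<sigma>}) (F (rev \<sigma>))"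

lemma simplicial_diff_reversal:
  "simplicial_diff (reversal F) \<sigma> = reversal (simplicial_diff F) \<sigma>"
proof -
  have "simplicial_diff (reversal F) \<sigma> =
      simplicial_diff (\<lambda>\<tau>. signed (\<Sum>{..<length \<sigma> - 1}) (F (rev \<tau>))) \<sigma>"
  proof (rule simplicial_diff_cong[where C = UNIV])
    fix \<tau> :: "'b list" assume "Suc (length \<tau>) = length \<sigma>"
    then have "length \<tau> = length \<sigma> - 1" by simp
    then show "reversal F \<tau> = signed (\<Sum>{..<length \<sigma> - 1}) (F (rev \<tau>))"
      by (simp only: reversal_def)
  qed simp
  also have "\<dots> = reversal (simplicial_diff F) \<sigma>"
    by (cases \<sigma>) (auto simp: simplicial_diff_signed simplicial_diff_rev signed_signed reversal_def)
  finally show ?thesis .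
qed

text \<open>The recursion solves \<open>K d + d K = reversal - id\<close> by coning from the first vertex.
  Here \<open>n\<close> is the number of vertices of the argument, so that \<open>F\<close> is a function of \<open>n + 1\<close> vertices.\<close>

primrec reversal_homotopy :: "nat \<Rightarrow> ('g list \<Rightarrow> 'a::ab_group_add) \<Rightarrow> 'g list \<Rightarrow> 'a" where
  "reversal_homotopy 0 F \<sigma> = 0"
| "reversal_homotopy (Suc n) F \<sigma> =
     reversal (\<lambda>\<tau>. F (hd \<sigma> # \<tau>)) \<sigma> - F (hd \<sigma> # \<sigma>)
     - simplicial_diff (reversal_homotopy n (\<lambda>\<tau>. F (hd \<sigma> # \<tau>))) \<sigma>"

text \<open>The homotopy uses nothing but the vertices of its argument, values of \<open>F\<close>
  and subtraction, so it is natural in both vertices and values. Translation and action by g give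
  equivariance; \<open>\<theta> = 0\<close> shows that it vanishes when \<open>F\<close> vanishes on
  lists over \<open>C\<close>.\<close>

lemma reversal_homotopy_map:
  assumes \<theta>: "\<And>a b. \<theta> (a - b) = \<theta> a - \<theta> b"
    and "\<sigma> \<in> lists C" "length \<sigma> = n"
    and "\<And>\<tau>. \<tau> \<in> lists C \<Longrightarrow> length \<tau> = Suc n \<Longrightarrow> F (map \<phi> \<tau>) = \<theta> (F' \<tau>)"
  shows "reversal_homotopy n F (map \<phi> \<sigma>) = \<theta> (reversal_homotopy n F' \<sigma>)"
  using assms(2-)
proof (induction n arbitrary: F F' \<sigma>)
  case 0
  then show ?case using diff_additive_0[of \<theta>, OF \<theta>] by simp
next
  case (Suc n)
  then obtain a \<rho> where \<sigma>: "\<sigma> = a # \<rho>" by (cases \<sigma>) auto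
  with Suc.prems have a: "a \<in> C" by auto
  have ih: "simplicial_diff (reversal_homotopy n (\<lambda>\<tau>. F (\<phi> a # \<tau>))) (map \<phi> \<sigma>) =
      \<theta> (simplicial_diff (reversal_homotopy n (\<lambda>\<tau>. F' (a # \<tau>))) \<sigma>)"
  proof (rule simplicial_diff_map[OF \<theta> Suc.prems(1)], rule Suc.IH)
    fix \<tau> \<upsilon> assume "\<upsilon> \<in> lists C" "length \<upsilon> = Suc n"
    then show "F (\<phi> a # map \<phi> \<upsilon>) = \<theta> (F' (a # \<upsilon>))"
      using Suc.prems(3)[of "a # \<upsilon>"] a by simp
  qed (use Suc.prems in auto)
  have "F (map \<phi> (a # \<sigma>)) = \<theta> (F' (a # \<sigma>))"
    by (rule Suc.prems(3)) (use Suc.prems a in auto)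
  moreover have "F (map \<phi> (a # rev \<sigma>)) = \<theta> (F' (a # rev \<sigma>))"
    by (rule Suc.prems(3)) (use Suc.prems a in auto)
  moreover have "hd (map \<phi> \<sigma>) = \<phi> a" "hd \<sigma> = a"
    by (simp_all add: \<sigma>)
  ultimately show ?case
    by (simp add: ih \<theta> reversal_def rev_map diff_additive_signed[of \<theta>, OF \<theta>])
qed

lemma reversal_homotopy_minus:
  "reversal_homotopy n (\<lambda>\<tau>. F \<tau> - F' \<tau>) =
     (\<lambda>\<sigma>. reversal_homotopy n F \<sigma> - reversal_homotopy n F' \<sigma>)"
  by (induction n arbitrary: F F') (auto simp: reversal_def signed_diff simplicial_diff_minus)

text \<open>Write T for \<open>reversal\<close>, d for \<open>simplicial_diff\<close>, K for the
  homotopy. Freezing the head of \<open>\<sigma>\<close> turns dF into F -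
  d\<open>F\<^sub>a\<close>. Hence K(dF) is TF - F - d(KF) minus the same expression formed from
  d\<open>F\<^sub>a\<close>, namely Td\<open>F\<^sub>a\<close> - d\<open>F\<^sub>a\<close> -
  dKd\<open>F\<^sub>a\<close>. By the induction hypothesis and dd = 0, the term
  dKd\<open>F\<^sub>a\<close> equals dT\<open>F\<^sub>a\<close> - d\<open>F\<^sub>a\<close>, and dT
  = Td makes the correction vanish.\<close>

lemma reversal_homotopy:
  "length \<sigma> = n \<Longrightarrow> reversal_homotopy n (simplicial_diff F) \<sigma>
     + simplicial_diff (reversal_homotopy (n - 1) F) \<sigma> = reversal F \<sigma> - F \<sigma>"
proof (induction n arbitrary: F \<sigma>)
  case 0
  then show ?case by (simp add: reversal_def)
next
  case (Suc n)
  \<comment> \<open>The cone vertex stays the head of the whole \<open>\<sigma>\<close>, also on the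
    face that omits it.\<close>
  define F\<^sub>a where "F\<^sub>a = (\<lambda>\<tau>. F (hd \<sigma> # \<tau>))"
  have "simplicial_diff (reversal_homotopy n (simplicial_diff F\<^sub>a)) \<sigma> =
      simplicial_diff (\<lambda>\<tau>. reversal F\<^sub>a \<tau> - F\<^sub>a \<tau> - simplicial_diff (reversal_homotopy (n - 1) F\<^sub>a) \<tau>) \<sigma>"
  proof (rule simplicial_diff_cong[where C = UNIV])
    fix \<tau> :: "'a list" assume "Suc (length \<tau>) = length \<sigma>"
    then show "reversal_homotopy n (simplicial_diff F\<^sub>a) \<tau> =
        reversal F\<^sub>a \<tau> - F\<^sub>a \<tau> - simplicial_diff (reversal_homotopy (n - 1) F\<^sub>a) \<tau>"
      using Suc.IH[of \<tau> F\<^sub>a] Suc.prems by (simp add: algebra_simps)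
  qed simp
  also have "\<dots> = reversal (simplicial_diff F\<^sub>a) \<sigma> - simplicial_diff F\<^sub>a \<sigma>"
    by (simp add: simplicial_diff_minus simplicial_diff_reversal)
  finally show ?case
    by (simp add: F\<^sub>a_def[symmetric] reversal_def signed_diff reversal_homotopy_minus
        simplicial_diff_minus algebra_simps)
qed

section \<open>The Alexander-Whitney product on vertex lists\<close>

text \<open>Front face and back face share the vertex with index \<open>r\<close>, hence the overlap
  of \<open>take (Suc r)\<close> and \<open>drop r\<close>. No action appears: the twist in the
  inhomogeneous formula is absorbed by homogeneity.\<close>

definition vertex_cup :: "('a \<Rightarrow> 'b \<Rightarrow> 'c) \<Rightarrow> nat \<Rightarrow> ('g list \<Rightarrow> 'a) \<Rightarrow> ('g list \<Rightarrow> 'b) \<Rightarrow> 'g list \<Rightarrow> 'c" where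
  "vertex_cup pair r F F' \<sigma> = pair (F (take (Suc r) \<sigma>)) (F' (drop r \<sigma>))"

text \<open>The induction peels vertices off the front face. All the content is in degree 0, where
  \<open>pair (F [a]) (F' (b # \<rho>))\<close> occurs in both summands on the right with opposite
  signs and cancels.\<close>

lemma simplicial_diff_vertex_cup:
  fixes pair :: "'a::ab_group_add \<Rightarrow> 'b::ab_group_add \<Rightarrow> 'c::ab_group_add"
  assumes l: "\<And>a a' b. pair (a - a') b = pair a b - pair a' b"
    and r: "\<And>a b b'. pair a (b - b') = pair a b - pair a b'"
    and "length \<sigma> \<ge> r + 2"
  shows "simplicial_diff (vertex_cup pair r F F') \<sigma> =
    vertex_cup pair (Suc r) (simplicial_diff F) F' \<sigma>
    + signed r (vertex_cup pair r F (simplicial_diff F') \<sigma>)"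
  using assms(3)
proof (induction r arbitrary: F \<sigma>)
  case 0
  then obtain a b \<rho> where \<sigma>: "\<sigma> = a # b # \<rho>"
    by (cases \<sigma>; cases "tl \<sigma>") auto
  have "simplicial_diff (\<lambda>\<tau>. pair (F [a]) (F' (a # \<tau>))) (b # \<rho>)
      = pair (F [a]) (simplicial_diff (\<lambda>\<tau>. F' (a # \<tau>)) (b # \<rho>))"
    using simplicial_diff_map[of "pair (F [a])" "b # \<rho>" UNIV "\<lambda>\<tau>. pair (F [a]) (F' (a # \<tau>))"
        "\<lambda>a. a" "\<lambda>\<tau>. F' (a # \<tau>)"] r by simp
  then show ?case
    by (simp add: \<sigma> vertex_cup_def[abs_def] l r del: simplicial_diff.simps(2))
       (simp add: \<sigma> l r)
next
  case (Suc r)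
  then obtain a \<rho> where \<sigma>: "\<sigma> = a # \<rho>" by (cases \<sigma>) auto
  show ?case
    using Suc.IH[of \<rho> "\<lambda>\<tau>. F (a # \<tau>)"] Suc.prems
    by (simp add: \<sigma> vertex_cup_def l algebra_simps)
qed

text \<open>This is the source of the sign (-1)^(rs): triangular numbers fail to be additive by
  exactly the product.\<close>

lemma triangular_sign:
  "\<Sum>{..<Suc (r + s)} = \<Sum>{..<Suc r} + \<Sum>{..<Suc s} + (r * s :: nat)"
  by (induction s) auto

text \<open>The front face of the reversed list is the reversed back face, so the factors trade
  places; the three reversal signs combine by \<open>triangular_sign\<close>.\<close>

lemma reversal_vertex_cup:
  fixes pair :: "'a::ab_group_add \<Rightarrow> 'b::ab_group_add \<Rightarrow> 'c::ab_group_add"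
  assumes l: "\<And>a a' b. pair (a - a') b = pair a b - pair a' b"
    and r: "\<And>a b b'. pair a (b - b') = pair a b - pair a b'"
    and n: "length \<sigma> = Suc (r + s)"
  shows "reversal (vertex_cup pair r F F') \<sigma> =
    signed (r * s) (vertex_cup (\<lambda>b a. pair a b) s (reversal F') (reversal F) \<sigma>)"
proof -
  have "pair (signed m a) b = signed m (pair a b)" "pair a (signed m b) = signed m (pair a b)" for m a b
    using diff_additive_signed[of "\<lambda>a. pair a b"] diff_additive_signed[of "pair a"] l r by auto
  then show ?thesis
    using n unfolding vertex_cup_def reversal_def
    by (simp add: take_rev drop_rev signed_signed triangular_sign ac_simps del: sum.lessThan_Suc)
qed

section \<open>Comparison with inhomogeneous cochains\<close>

definition steps :: "('g, 'm) monoid_scheme \<Rightarrow> 'g list \<Rightarrow> nat \<Rightarrow> 'g" where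
  "steps G \<sigma> = (\<lambda>j\<in>{..<length \<sigma> - 1}. inv\<^bsub>G\<^esub> (\<sigma> ! j) \<otimes>\<^bsub>G\<^esub> \<sigma> ! Suc j)"

definition homogenize ::
  "('g, 'm) monoid_scheme \<Rightarrow> ('g \<Rightarrow> 'a \<Rightarrow> 'a) \<Rightarrow> ((nat \<Rightarrow> 'g) \<Rightarrow> 'a) \<Rightarrow> 'g list \<Rightarrow> 'a" where
  "homogenize G act f \<sigma> = act (hd \<sigma>) (f (steps G \<sigma>))"

text \<open>The path 1, x_1, x_1 x_2, ... is the representative with head \<open>\<one>\<close> of
  an orbit of vertex lists under left translation. It is a right inverse of \<open>steps\<close>; in
  the other order the composite translates a list by the inverse of its head.\<close>

definition vertices :: "('g, 'm) monoid_scheme \<Rightarrow> nat \<Rightarrow> (nat \<Rightarrow> 'g) \<Rightarrow> 'g list" where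
  "vertices G r x = map (\<lambda>k. tuple_prod G k x) [0..<Suc r]"

definition inhomogenize ::
  "('g, 'm) monoid_scheme \<Rightarrow> nat \<Rightarrow> ('g list \<Rightarrow> 'a::ab_group_add) \<Rightarrow> (nat \<Rightarrow> 'g) \<Rightarrow> 'a" where
  "inhomogenize G r F x = (if x \<in> tuples G r then F (vertices G r x) else 0)"

definition reverse_cochain ::
  "('g, 'm) monoid_scheme \<Rightarrow> ('g \<Rightarrow> 'a \<Rightarrow> 'a) \<Rightarrow> nat
     \<Rightarrow> ((nat \<Rightarrow> 'g) \<Rightarrow> 'a::ab_group_add) \<Rightarrow> (nat \<Rightarrow> 'g) \<Rightarrow> 'a" where
  "reverse_cochain G act r f = inhomogenize G r (reversal (homogenize G act f))"

lemma tuples_iff: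
  "x \<in> tuples G r \<longleftrightarrow> (\<forall>j<r. x j \<in> carrier G) \<and> (\<forall>j\<ge>r. x j = undefined)"
  by (auto simp: tuples_def PiE_iff extensional_def)

lemma tuples_eqI:
  "x \<in> tuples G r \<Longrightarrow> y \<in> tuples G r \<Longrightarrow> (\<And>j. j < r \<Longrightarrow> x j = y j) \<Longrightarrow> x = y"
  unfolding tuples_def by (rule PiE_ext) auto

context group
begin

lemma tuple_prod_closed: "(\<And>j. j < k \<Longrightarrow> x j \<in> carrier G) \<Longrightarrow> tuple_prod G k x \<in> carrier G"
proof -
  have "foldr (\<otimes>) ys \<one> \<in> carrier G" if "set ys \<subseteq> carrier G" for ys
    using that by (induction ys) auto
  then show "tuple_prod G k x \<in> carrier G" if "\<And>j. j < k \<Longrightarrow> x j \<in> carrier G"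
    using that unfolding tuple_prod_def by (auto simp: image_subset_iff)
qed

lemma tuple_prod_0 [simp]: "tuple_prod G 0 x = \<one>"
  by (simp add: tuple_prod_def)

text \<open>The product is a right fold ending in \<open>\<one>\<close>, so a factor appended at the
  end has to be moved outwards by associativity.\<close>

lemma tuple_prod_Suc:
  assumes "\<And>j. j \<le> k \<Longrightarrow> x j \<in> carrier G"
  shows "tuple_prod G (Suc k) x = tuple_prod G k x \<otimes> x k"
proof -
  have "foldr (\<otimes>) (ys @ [z]) \<one> = foldr (\<otimes>) ys \<one> \<otimes> z \<and> foldr (\<otimes>) ys \<one> \<in> carrier G"
    if "set ys \<subseteq> carrier G" "z \<in> carrier G" for ys z
    using that by (induction ys) (auto simp: m_assoc)
  from this[of "map x [0..<k]" "x k"] show ?thesis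
    using assms unfolding tuple_prod_def by (simp add: image_subset_iff)
qed

lemma steps_in_tuples: "\<sigma> \<in> lists (carrier G) \<Longrightarrow> length \<sigma> = Suc r \<Longrightarrow> steps G \<sigma> \<in> tuples G r"
  by (auto simp: steps_def tuples_iff in_listsI)

lemma length_vertices [simp]: "length (vertices G r x) = Suc r"
  by (simp add: vertices_def)

lemma hd_vertices [simp]: "hd (vertices G r x) = \<one>"
  by (simp add: vertices_def upt_conv_Cons del: upt_Suc)

lemma nth_vertices: "k \<le> r \<Longrightarrow> vertices G r x ! k = tuple_prod G k x"
  unfolding vertices_def by (subst nth_map) (simp_all del: upt_Suc)

lemma vertices_in_lists: "x \<in> tuples G r \<Longrightarrow> vertices G r x \<in> lists (carrier G)"
  by (auto simp: vertices_def tuples_iff intro!: tuple_prod_closed)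

lemma steps_vertices: "x \<in> tuples G r \<Longrightarrow> steps G (vertices G r x) = x"
proof (rule tuples_eqI)
  fix j assume x: "x \<in> tuples G r" "j < r"
  then have "tuple_prod G (Suc j) x = tuple_prod G j x \<otimes> x j"
    by (intro tuple_prod_Suc) (auto simp: tuples_iff)
  moreover have "tuple_prod G j x \<in> carrier G" "x j \<in> carrier G"
    using x by (auto simp: tuples_iff intro!: tuple_prod_closed)
  ultimately show "steps G (vertices G r x) j = x j"
    using x by (simp add: steps_def nth_vertices m_assoc[symmetric])
qed (auto intro: steps_in_tuples[OF vertices_in_lists])

text \<open>The product telescopes.\<close>

lemma tuple_prod_steps:
  assumes "\<sigma> \<in> lists (carrier G)" "k < length \<sigma>"
  shows "tuple_prod G k (steps G \<sigma>) = inv (hd \<sigma>) \<otimes> \<sigma> ! k"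
  using assms(2)
proof (induction k)
  case 0
  then have "hd \<sigma> \<in> carrier G" using assms by (cases \<sigma>) auto
  with 0 show ?case by (simp add: hd_conv_nth)
next
  case (Suc k)
  have c: "\<sigma> ! j \<in> carrier G" if "j < length \<sigma>" for j
    using assms(1) that by auto
  have "hd \<sigma> \<in> carrier G" using c[of 0] Suc.prems by (cases \<sigma>) auto
  moreover have "tuple_prod G (Suc k) (steps G \<sigma>) = tuple_prod G k (steps G \<sigma>) \<otimes> steps G \<sigma> k"
    using Suc.prems c by (intro tuple_prod_Suc) (auto simp: steps_def)
  moreover have "inv (\<sigma> ! k) \<otimes> \<sigma> ! Suc k \<in> carrier G"
    using c Suc.prems by auto
  moreover have "steps G \<sigma> k = inv (\<sigma> ! k) \<otimes> \<sigma> ! Suc k"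
    using Suc.prems by (auto simp: steps_def)
  moreover have "\<sigma> ! k \<otimes> (inv (\<sigma> ! k) \<otimes> \<sigma> ! Suc k) = \<sigma> ! Suc k"
    using c Suc.prems by (simp add: m_assoc[symmetric])
  ultimately show ?case
    using Suc c[of k] c[of "Suc k"] by (simp add: m_assoc)
qed

lemma vertices_steps:
  assumes "\<sigma> \<in> lists (carrier G)" "length \<sigma> = Suc r"
  shows "vertices G r (steps G \<sigma>) = map ((\<otimes>) (inv (hd \<sigma>))) \<sigma>"
  by (rule nth_equalityI) (use assms in \<open>auto simp: nth_vertices tuple_prod_steps\<close>)

lemma steps_translate:
  assumes "g \<in> carrier G" "\<sigma> \<in> lists (carrier G)"
  shows "steps G (map ((\<otimes>) g) \<sigma>) = steps G \<sigma>"
proof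
  fix j
  have "inv (g \<otimes> a) \<otimes> (g \<otimes> b) = inv a \<otimes> b" if "a \<in> carrier G" "b \<in> carrier G" for a b
    using assms(1) that inv_solve_left[of "inv a \<otimes> b" "g \<otimes> a" "g \<otimes> b"]
    by (simp add: m_assoc) (simp flip: m_assoc)
  then show "steps G (map ((\<otimes>) g) \<sigma>) j = steps G \<sigma> j"
    using assms(2) by (auto simp: steps_def)
qed

end

text \<open>Multiplying the two steps adjacent to an interior vertex gives the step that bypasses
  it. The 1-based index of \<open>merge\<close> is then precisely the 0-based position of the
  omitted vertex.\<close>

lemma (in group) merge_steps:
  assumes "\<sigma> \<in> lists (carrier G)" "length \<sigma> = Suc (Suc r)" "1 \<le> i" "i \<le> r"
  shows "merge G r i (steps G \<sigma>) = steps G (take i \<sigma> @ drop (Suc i) \<sigma>)"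
proof
  fix j
  have c: "\<sigma> ! j \<in> carrier G" if "j < length \<sigma>" for j
    using assms(1) that by auto
  have m: "inv a \<otimes> b \<otimes> (inv b \<otimes> d) = inv a \<otimes> d"
    if "a \<in> carrier G" "b \<in> carrier G" "d \<in> carrier G" for a b d
    using that by (simp add: m_assoc) (simp add: m_assoc[symmetric])
  show "merge G r i (steps G \<sigma>) j = steps G (take i \<sigma> @ drop (Suc i) \<sigma>) j"
  proof (cases "j < r")
    case False
    then show ?thesis using assms by (simp add: merge_def steps_def)
  next
    case True
    have nth: "(take i \<sigma> @ drop (Suc i) \<sigma>) ! k = (if k < i then \<sigma> ! k else \<sigma> ! Suc k)" if "k \<le> r" for k
      using that assms by (auto simp: nth_append min_def)
    show ?thesis
      using True assms c m by (auto simp: merge_def steps_def nth)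
  qed
qed

context discrete_module
begin

lemma act_diff: "x \<in> carrier G \<Longrightarrow> act x (a - b) = act x a - act x b"
  using additive_diff[of "act x"] act_add by blast

lemma act_signed: "x \<in> carrier G \<Longrightarrow> act x (signed n a) = signed n (act x a)"
  by (rule diff_additive_signed) (rule act_diff)

lemma act_0: "x \<in> carrier G \<Longrightarrow> act x 0 = 0"
  using act_diff[of x 0 0] by simp

lemma homogenize_equivariant:
  assumes "g \<in> carrier G" "\<sigma> \<in> lists (carrier G)" "\<sigma> \<noteq> []"
  shows "homogenize G act f (map ((\<otimes>) g) \<sigma>) = act g (homogenize G act f \<sigma>)"
proof -
  have "hd \<sigma> \<in> carrier G" using assms by (cases \<sigma>) auto
  then show ?thesis
    using assms by (simp add: homogenize_def steps_translate hd_map act_mult)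
qed

lemma homogenize_vertices:
  assumes "x \<in> tuples G r"
  shows "homogenize G act f (vertices G r x) = f x"
  using assms by (simp add: homogenize_def steps_vertices act_one)

text \<open>This transfers identities from vertex lists back to cochains. Homogenization sees only
  genuine tuples, so vanishing elsewhere has to be assumed.\<close>

lemma homogenize_inject:
  assumes "\<And>x. x \<notin> tuples G r \<Longrightarrow> f x = 0" "\<And>x. x \<notin> tuples G r \<Longrightarrow> f' x = 0"
    and "\<And>\<sigma>. \<sigma> \<in> lists (carrier G) \<Longrightarrow> length \<sigma> = Suc r \<Longrightarrow>
      homogenize G act f \<sigma> = homogenize G act f' \<sigma>"
  shows "f = f'"
proof
  fix x show "f x = f' x"
    using assms(1,2)[of x] assms(3)[of "vertices G r x"]
    by (cases "x \<in> tuples G r") (auto simp: homogenize_vertices vertices_in_lists)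
qed

text \<open>Inhomogenizing remembers only the values on lists with head \<open>\<one>\<close>;
  equivariance recovers the value at \<open>\<sigma>\<close> after translating its head to
  \<open>\<one>\<close> and back.\<close>

lemma homogenize_inhomogenize:
  assumes eq: "\<And>g \<sigma>. g \<in> carrier G \<Longrightarrow> \<sigma> \<in> lists (carrier G) \<Longrightarrow> length \<sigma> = Suc r \<Longrightarrow>
      F (map ((\<otimes>) g) \<sigma>) = act g (F \<sigma>)"
    and \<sigma>: "\<sigma> \<in> lists (carrier G)" "length \<sigma> = Suc r"
  shows "homogenize G act (inhomogenize G r F) \<sigma> = F \<sigma>"
proof -
  have h: "hd \<sigma> \<in> carrier G" using \<sigma> by (cases \<sigma>) auto
  have "map ((\<otimes>) (hd \<sigma>)) (map ((\<otimes>) (inv (hd \<sigma>))) \<sigma>) = \<sigma>"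
    unfolding map_map using \<sigma> h by (intro map_idI) (auto simp: m_assoc[symmetric])
  moreover have "map ((\<otimes>) (inv (hd \<sigma>))) \<sigma> \<in> lists (carrier G)"
    using h \<sigma> by auto
  ultimately show ?thesis
    using eq[of "hd \<sigma>" "map ((\<otimes>) (inv (hd \<sigma>))) \<sigma>"] h \<sigma>
    by (simp add: homogenize_def inhomogenize_def steps_in_tuples vertices_steps del: map_map)
qed

text \<open>The terms match face by face: the term with the action of x_1 omits the first vertex,
  each merge omits an interior one, and the restriction omits the last.\<close>

lemma homogenize_coboundary:
  assumes \<sigma>: "\<sigma> \<in> lists (carrier G)" "length \<sigma> = Suc (Suc r)"
  shows "homogenize G act (coboundary G act r f) \<sigma> = simplicial_diff (homogenize G act f) \<sigma>"
proof -
  let ?x = "steps G \<sigma>"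
  let ?del = "\<lambda>i. take i \<sigma> @ drop (Suc i) \<sigma>"
  obtain a b \<rho> where ab: "\<sigma> = a # b # \<rho>" using \<sigma>(2) by (cases \<sigma>; cases "tl \<sigma>") auto
  have c: "a \<in> carrier G" "b \<in> carrier G" using \<sigma> ab by auto
  have first: "act a (act (?x 0) (f (\<lambda>j\<in>{..<r}. ?x (Suc j)))) = homogenize G act f (?del 0)"
  proof -
    have "(\<lambda>j\<in>{..<r}. ?x (Suc j)) = steps G (b # \<rho>)"
      using \<sigma> by (auto simp: steps_def ab)
    \<comment> \<open>Acting by the head and then by the first step is acting by the second vertex,
      which heads the face.\<close>
    moreover have "a \<otimes> ?x 0 = b" "?x 0 \<in> carrier G"
      using c by (auto simp: steps_def ab m_assoc[symmetric])
    ultimately show ?thesis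
      using c by (simp add: homogenize_def ab flip: act_mult)
  qed
  have middle: "act a (f (merge G r i ?x)) = homogenize G act f (?del i)" if "i \<in> {1..r}" for i
  proof -
    have "hd (?del i) = a" using that by (cases i) (auto simp: ab)
    then show ?thesis
      using that merge_steps[OF \<sigma>, of i] by (simp add: homogenize_def)
  qed
  have last: "act a (f (restrict ?x {..<r})) = homogenize G act f (?del (Suc r))"
  proof -
    have "restrict ?x {..<r} = steps G (take (Suc r) \<sigma>)"
      using \<sigma> by (auto simp: steps_def)
    then show ?thesis
      using \<sigma> by (simp add: homogenize_def ab)
  qed
  have sum: "act a (\<Sum>i\<in>I. h i) = (\<Sum>i\<in>I. act a (h i))" if "finite I" for I :: "nat set" and h
    using that by induction (auto simp: act_add act_0 c)
  have "homogenize G act (coboundary G act r f) \<sigma> =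
      act a (act (?x 0) (f (\<lambda>j\<in>{..<r}. ?x (Suc j)))) + (\<Sum>i=1..r. signed i (act a (f (merge G r i ?x))))
      + signed (Suc r) (act a (f (restrict ?x {..<r})))"
    using c steps_in_tuples[OF \<sigma>]
    by (simp add: homogenize_def coboundary_def ab act_add sum act_signed del: signed_Suc)
  also have "\<dots> = (\<Sum>i<Suc (Suc r). signed i (homogenize G act f (?del i)))"
    unfolding first last sum.lessThan_Suc[of _ "Suc r"]
    by (simp add: middle sum.lessThan_Suc_shift sum.atLeast1_atMost_eq lessThan_Suc_atMost[symmetric]
        del: sum.lessThan_Suc signed_Suc cong: sum.cong_simp)
  finally show ?thesis
    using \<sigma> by (simp only: simplicial_diff_eq_sum)
qed

lemma homogenize_reverse_cochain:
  assumes "\<sigma> \<in> lists (carrier G)" "length \<sigma> = Suc r"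
  shows "homogenize G act (reverse_cochain G act r f) \<sigma> = reversal (homogenize G act f) \<sigma>"
  unfolding reverse_cochain_def
proof (rule homogenize_inhomogenize)
  fix g \<sigma> assume g: "g \<in> carrier G" and \<sigma>: "\<sigma> \<in> lists (carrier G)" "length \<sigma> = Suc r"
  have "homogenize G act f (map ((\<otimes>) g) (rev \<sigma>)) = act g (homogenize G act f (rev \<sigma>))"
    using g \<sigma> by (intro homogenize_equivariant) auto
  then show "reversal (homogenize G act f) (map ((\<otimes>) g) \<sigma>) = act g (reversal (homogenize G act f) \<sigma>)"
    by (simp only: reversal_def rev_map length_map act_signed[OF g])
qed (rule assms)+

end

text \<open>The head of \<open>\<sigma>\<close> times the product of the first \<open>r\<close>
  steps is the vertex with index \<open>r\<close>, the head of the back face; this absorbs the twist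
  in the cup product.\<close>

lemma (in G_bilinear) homogenize_cup:
  assumes \<sigma>: "\<sigma> \<in> lists (carrier G)" "length \<sigma> = Suc (r + s)"
  shows "homogenize G actC (cup G actB pair r s f f') \<sigma> =
    vertex_cup pair r (homogenize G actA f) (homogenize G actB f') \<sigma>"
proof -
  let ?x = "steps G \<sigma>"
  have c: "\<sigma> ! j \<in> carrier G" if "j < length \<sigma>" for j
    using \<sigma>(1) that by auto
  have "hd \<sigma> \<in> carrier G"
    using \<sigma> by (cases \<sigma>) auto
  note h = this c[of r]
  have f: "restrict ?x {..<r} = steps G (take (Suc r) \<sigma>)"
    using \<sigma> by (auto simp: steps_def)
  have f': "(\<lambda>j\<in>{..<s}. ?x (r + j)) = steps G (drop r \<sigma>)"
    using \<sigma> by (auto simp: steps_def)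
  have "tuple_prod G r ?x = inv (hd \<sigma>) \<otimes> \<sigma> ! r"
    using \<sigma> by (intro left.tuple_prod_steps) auto
  then have "actB (hd \<sigma>) (actB (tuple_prod G r ?x) b) = actB (\<sigma> ! r) b" for b
    using h \<sigma> by (simp add: left.m_assoc[symmetric] flip: right.act_mult)
  moreover have "hd (take (Suc r) \<sigma>) = hd \<sigma>" "hd (drop r \<sigma>) = \<sigma> ! r"
    using \<sigma> by (auto simp: hd_drop_conv_nth hd_conv_nth)
  ultimately show ?thesis
    using left.steps_in_tuples[OF \<sigma>] h
    by (simp add: homogenize_def cup_def vertex_cup_def equivariant f f')
qed

section \<open>Continuity\<close>

text \<open>Continuity of a family of lists of fixed length is expressed coordinatewise over an
  arbitrary parameter space, which avoids topologizing lists.\<close>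

definition continuous_list :: "'x topology \<Rightarrow> 'g topology \<Rightarrow> nat \<Rightarrow> ('x \<Rightarrow> 'g list) \<Rightarrow> bool" where
  "continuous_list X T n L \<longleftrightarrow>
     (\<forall>x\<in>topspace X. length (L x) = n) \<and> (\<forall>i<n. continuous_map X T (\<lambda>x. L x ! i))"

text \<open>The function may itself vary with the parameter. The recursions for the differential and
  the homotopy need this, since they replace \<open>F\<close> by \<open>F (hd \<sigma> # _)\<close>,
  which depends on the point through the head.\<close>

definition continuous_on_lists ::
  "'x topology \<Rightarrow> 'g topology \<Rightarrow> nat \<Rightarrow> ('x \<Rightarrow> 'g list \<Rightarrow> 'a) \<Rightarrow> bool" where
  "continuous_on_lists X T n F \<longleftrightarrow>
     (\<forall>L. continuous_list X T n L \<longrightarrow> continuous_map X (discrete_topology UNIV) (\<lambda>x. F x (L x)))"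

lemma continuous_map_discrete_binop:
  assumes "continuous_map X (discrete_topology UNIV) f" "continuous_map X (discrete_topology UNIV) g"
  shows "continuous_map X (discrete_topology UNIV) (\<lambda>x. h (f x) (g x))"
proof -
  have "continuous_map X (discrete_topology UNIV) (\<lambda>x. (f x, g x))"
    using continuous_map_pairedI[OF assms] by (simp flip: prod_topology_discrete_topology)
  moreover have "continuous_map (discrete_topology UNIV) (discrete_topology UNIV) (\<lambda>(a, b). h a b)"
    by simp
  ultimately show ?thesis
    using continuous_map_compose[of X _ "\<lambda>x. (f x, g x)" _ "\<lambda>(a, b). h a b"] by (simp add: o_def)
qed

lemma continuous_map_discrete_unop:
  "continuous_map X (discrete_topology UNIV) f \<Longrightarrow> continuous_map X (discrete_topology UNIV) (\<lambda>x. h (f x))"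
  using continuous_map_discrete_binop[of X f f "\<lambda>a b. h a"] by simp

lemma continuous_list_reindex:
  assumes "continuous_list X T n L" "\<And>i. i < m \<Longrightarrow> \<phi> i < n"
    and "\<And>x. x \<in> topspace X \<Longrightarrow> length (L x) = n \<Longrightarrow> length (M x) = m"
    and "\<And>x i. x \<in> topspace X \<Longrightarrow> length (L x) = n \<Longrightarrow> i < m \<Longrightarrow> M x ! i = L x ! \<phi> i"
  shows "continuous_list X T m M"
  unfolding continuous_list_def
proof (intro conjI allI impI ballI)
  fix i assume "i < m"
  then show "continuous_map X T (\<lambda>x. M x ! i)"
    using assms by - (rule continuous_map_eq[of X T "\<lambda>x. L x ! \<phi> i"], auto simp: continuous_list_def)
qed (use assms in \<open>auto simp: continuous_list_def\<close>)

lemma continuous_list_tl: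
  "continuous_list X T (Suc n) L \<Longrightarrow> continuous_list X T n (\<lambda>x. tl (L x))"
  by (erule continuous_list_reindex[where \<phi> = Suc]) (auto simp: nth_tl)

lemma continuous_list_rev:
  "continuous_list X T n L \<Longrightarrow> continuous_list X T n (\<lambda>x. rev (L x))"
  by (erule continuous_list_reindex[where \<phi> = "\<lambda>i. n - Suc i"]) (auto simp: rev_nth)

lemma continuous_list_take:
  "continuous_list X T n L \<Longrightarrow> m \<le> n \<Longrightarrow> continuous_list X T m (\<lambda>x. take m (L x))"
  by (erule continuous_list_reindex[where \<phi> = "\<lambda>i. i"]) auto

lemma continuous_list_drop:
  "continuous_list X T (m + n) L \<Longrightarrow> continuous_list X T n (\<lambda>x. drop m (L x))"
  by (erule continuous_list_reindex[where \<phi> = "\<lambda>i. m + i"]) auto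

lemma continuous_list_Cons:
  "continuous_map X T a \<Longrightarrow> continuous_list X T n L \<Longrightarrow> continuous_list X T (Suc n) (\<lambda>x. a x # L x)"
  by (auto simp: continuous_list_def less_Suc_eq_0_disj)

lemma continuous_list_hd:
  assumes "continuous_list X T (Suc n) L"
  shows "continuous_map X T (\<lambda>x. hd (L x))"
proof (rule continuous_map_eq)
  show "continuous_map X T (\<lambda>x. L x ! 0)"
    using assms by (auto simp: continuous_list_def)
  fix x assume "x \<in> topspace X"
  then have "L x \<noteq> []" using assms by (auto simp: continuous_list_def)
  then show "L x ! 0 = hd (L x)" by (simp add: hd_conv_nth)
qed

lemma continuous_on_listsD:
  "continuous_on_lists X T n F \<Longrightarrow> continuous_list X T n L \<Longrightarrow>
     continuous_map X (discrete_topology UNIV) (\<lambda>x. F x (L x))"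
  by (simp add: continuous_on_lists_def)

lemma continuous_on_lists_Cons:
  "continuous_on_lists X T (Suc n) F \<Longrightarrow> continuous_map X T a \<Longrightarrow>
     continuous_on_lists X T n (\<lambda>x \<tau>. F x (a x # \<tau>))"
  by (auto simp: continuous_on_lists_def intro: continuous_list_Cons)

lemma continuous_on_lists_simplicial_diff:
  assumes "continuous_on_lists X T n F"
  shows "continuous_on_lists X T (Suc n) (\<lambda>x. simplicial_diff (F x))"
  using assms
proof (induction n arbitrary: F)
  case 0
  show ?case
    unfolding continuous_on_lists_def
  proof (intro allI impI)
    fix L assume L: "continuous_list X T (Suc 0) L"
    have "continuous_map X (discrete_topology UNIV) (\<lambda>x. F x (tl (L x)))"
      by (rule continuous_on_listsD[OF 0 continuous_list_tl[OF L]])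
    then show "continuous_map X (discrete_topology UNIV) (\<lambda>x. simplicial_diff (F x) (L x))"
    proof (rule continuous_map_eq)
      fix x assume "x \<in> topspace X"
      then obtain a where "L x = [a]"
        using L by (auto simp: continuous_list_def length_Suc_conv)
      then show "F x (tl (L x)) = simplicial_diff (F x) (L x)" by simp
    qed
  qed
next
  case (Suc n)
  show ?case
    unfolding continuous_on_lists_def
  proof (intro allI impI)
    fix L assume L: "continuous_list X T (Suc (Suc n)) L"
    have "continuous_on_lists X T (Suc n) (\<lambda>x. simplicial_diff (\<lambda>\<tau>. F x (hd (L x) # \<tau>)))"
      by (rule Suc.IH) (rule continuous_on_lists_Cons[OF Suc.prems continuous_list_hd[OF L]])
    then have "continuous_map X (discrete_topology UNIV)
        (\<lambda>x. F x (tl (L x)) - simplicial_diff (\<lambda>\<tau>. F x (hd (L x) # \<tau>)) (tl (L x)))"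
      by (intro continuous_map_discrete_binop[where h = "(-)"] continuous_on_listsD[OF Suc.prems]
          continuous_list_tl[OF L]) (erule continuous_on_listsD, rule continuous_list_tl[OF L])
    then show "continuous_map X (discrete_topology UNIV) (\<lambda>x. simplicial_diff (F x) (L x))"
    proof (rule continuous_map_eq)
      fix x assume "x \<in> topspace X"
      then have "L x \<noteq> []" using L by (auto simp: continuous_list_def)
      then show "F x (tl (L x)) - simplicial_diff (\<lambda>\<tau>. F x (hd (L x) # \<tau>)) (tl (L x)) =
          simplicial_diff (F x) (L x)"
        by (cases "L x") auto
    qed
  qed
qed

lemma continuous_on_lists_reversal:
  assumes "continuous_on_lists X T n F"
  shows "continuous_on_lists X T n (\<lambda>x. reversal (F x))"
  unfolding continuous_on_lists_def
proof (intro allI impI)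
  fix L assume L: "continuous_list X T n L"
  have "continuous_map X (discrete_topology UNIV) (\<lambda>x. signed (\<Sum>{..<n}) (F x (rev (L x))))"
    by (rule continuous_map_discrete_unop, rule continuous_on_listsD[OF assms continuous_list_rev[OF L]])
  then show "continuous_map X (discrete_topology UNIV) (\<lambda>x. reversal (F x) (L x))"
    by (rule continuous_map_eq) (use L in \<open>auto simp: reversal_def continuous_list_def\<close>)
qed

lemma continuous_on_lists_reversal_homotopy:
  "continuous_on_lists X T (Suc n) F \<Longrightarrow> continuous_on_lists X T n (\<lambda>x. reversal_homotopy n (F x))"
proof (induction n arbitrary: F)
  case 0
  show ?case by (simp add: continuous_on_lists_def)
next
  case (Suc n)
  show ?case
    unfolding continuous_on_lists_def reversal_homotopy.simps
  proof (intro allI impI)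
    fix L assume L: "continuous_list X T (Suc n) L"
    have F: "continuous_on_lists X T (Suc n) (\<lambda>x \<tau>. F x (hd (L x) # \<tau>))"
      by (rule continuous_on_lists_Cons[OF Suc.prems continuous_list_hd[OF L]])
    show "continuous_map X (discrete_topology UNIV) (\<lambda>x. reversal (\<lambda>\<tau>. F x (hd (L x) # \<tau>)) (L x)
        - F x (hd (L x) # L x) - simplicial_diff (reversal_homotopy n (\<lambda>\<tau>. F x (hd (L x) # \<tau>))) (L x))"
      by (intro continuous_map_discrete_binop[where h = "(-)"] continuous_on_listsD[OF _ L]
          continuous_on_listsD[OF F L] continuous_on_lists_reversal F
          continuous_on_lists_simplicial_diff Suc.IH)
  qed
qed

lemma continuous_on_lists_vertex_cup:
  assumes "continuous_on_lists X T (Suc r) F" "continuous_on_lists X T (Suc s) F'"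
  shows "continuous_on_lists X T (Suc (r + s)) (\<lambda>x. vertex_cup pair r (F x) (F' x))"
  unfolding continuous_on_lists_def vertex_cup_def
proof (intro allI impI continuous_map_discrete_binop[where h = pair]
    continuous_on_listsD[OF assms(1)] continuous_on_listsD[OF assms(2)])
  fix L assume "continuous_list X T (Suc (r + s)) L"
  then show "continuous_list X T (Suc r) (\<lambda>x. take (Suc r) (L x))"
    "continuous_list X T (Suc s) (\<lambda>x. drop r (L x))"
    by (auto intro: continuous_list_take continuous_list_drop)
qed

text \<open>Passing between steps and vertices continuously requires continuous multiplication and
  inversion, which \<open>discrete_module\<close> does not contain.\<close>

locale profinite_module = profinite_group G T + discrete_module G T act
  for G :: "('g, 'm) monoid_scheme" (structure) and T :: "'g topology"
    and act :: "'g \<Rightarrow> 'a::ab_group_add \<Rightarrow> 'a"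

context profinite_group
begin

lemma topspace_tuples: "topspace (product_topology (\<lambda>_. T) {..<r}) = tuples G r"
  by (simp add: topspace_eq tuples_def)

lemma continuous_map_mult:
  "continuous_map X T f \<Longrightarrow> continuous_map X T g \<Longrightarrow> continuous_map X T (\<lambda>x. f x \<otimes> g x)"
  using continuous_map_compose[OF continuous_map_pairedI continuous_mult, of X f g] by (simp add: o_def)

lemma continuous_list_vertices:
  "continuous_list (product_topology (\<lambda>_. T) {..<r}) T (Suc r) (vertices G r)"
proof -
  have "continuous_map (product_topology (\<lambda>_. T) {..<r}) T (\<lambda>x. tuple_prod G k x)" if "k \<le> r" for k
    using that
  proof (induction k)
    case 0
    show ?case by (simp add: topspace_eq)
  next
    case (Suc k)
    then have "continuous_map (product_topology (\<lambda>_. T) {..<r}) T (\<lambda>x. tuple_prod G k x \<otimes> x k)"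
      by (intro continuous_map_mult continuous_map_product_projection) auto
    then show ?case
    proof (rule continuous_map_eq)
      fix x assume "x \<in> topspace (product_topology (\<lambda>_. T) {..<r})"
      then have "x j \<in> carrier G" if "j \<le> k" for j
        using that Suc.prems by (simp only: topspace_tuples) (simp add: tuples_iff)
      then show "tuple_prod G k x \<otimes> x k = tuple_prod G (Suc k) x"
        by (rule tuple_prod_Suc[symmetric])
    qed
  qed
  then show ?thesis
    by (simp add: continuous_list_def nth_vertices)
qed

lemma inhomogenize_in_cochains:
  assumes "continuous_on_lists (product_topology (\<lambda>_. T) {..<r}) T (Suc r) (\<lambda>_. F)"
  shows "inhomogenize G r F \<in> cochains G T r"
proof -
  have "continuous_map (product_topology (\<lambda>_. T) {..<r}) (discrete_topology UNIV) (inhomogenize G r F)"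
    by (rule continuous_map_eq[OF continuous_on_listsD[OF assms continuous_list_vertices]])
       (simp only: topspace_tuples inhomogenize_def if_True)
  then show ?thesis by (simp add: cochains_def inhomogenize_def)
qed

end

text \<open>The steps depend continuously on the vertices, and the action is jointly continuous in
  the head and the discrete value.\<close>

lemma (in profinite_module) continuous_on_lists_homogenize:
  assumes "f \<in> cochains G T r"
  shows "continuous_on_lists X T (Suc r) (\<lambda>_. homogenize G act f)"
  unfolding continuous_on_lists_def homogenize_def
proof (intro allI impI)
  fix L assume L: "continuous_list X T (Suc r) L"
  have "continuous_map X (product_topology (\<lambda>_. T) {..<r}) (\<lambda>x. steps G (L x))"
    unfolding continuous_map_componentwise
  proof (intro conjI ballI image_subsetI)
    fix x assume x: "x \<in> topspace X"
    show "steps G (L x) \<in> extensional {..<r}"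
      using L x by (simp add: steps_def continuous_list_def)
  next
    fix j assume "j \<in> {..<r}"
    then have "continuous_map X T (\<lambda>x. inv (L x ! j) \<otimes> L x ! Suc j)"
      using L continuous_map_compose[OF _ continuous_inv, of X "\<lambda>x. L x ! j"]
      by (intro continuous_map_mult) (auto simp: continuous_list_def o_def)
    then show "continuous_map X T (\<lambda>x. steps G (L x) j)"
      by (rule continuous_map_eq) (use L \<open>j \<in> {..<r}\<close> in \<open>auto simp: steps_def continuous_list_def\<close>)
  qed
  moreover have "continuous_map (product_topology (\<lambda>_. T) {..<r}) (discrete_topology UNIV) f"
    using assms by (simp add: cochains_def)
  ultimately have "continuous_map X (discrete_topology UNIV) (\<lambda>x. f (steps G (L x)))"
    by (rule continuous_map_compose[unfolded o_def])
  then have "continuous_map X (prod_topology T (discrete_topology UNIV)) (\<lambda>x. (hd (L x), f (steps G (L x))))"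
    using continuous_list_hd[OF L] by (rule continuous_map_pairedI[rotated])
  from continuous_map_compose[OF this act_continuous]
  show "continuous_map X (discrete_topology UNIV) (\<lambda>x. act (hd (L x)) (f (steps G (L x))))"
    by (simp add: o_def)
qed

section \<open>Cochain calculus\<close>

lemma cochains_vanish: "f \<in> cochains G T r \<Longrightarrow> x \<notin> tuples G r \<Longrightarrow> f x = 0"
  by (simp add: cochains_def)

lemma cochains_binop:
  "f \<in> cochains G T r \<Longrightarrow> g \<in> cochains G T r \<Longrightarrow> h 0 0 = 0 \<Longrightarrow> (\<lambda>x. h (f x) (g x)) \<in> cochains G T r"
  by (simp add: cochains_def continuous_map_discrete_binop)

lemma cochains_comp:
  "f \<in> cochains G T r \<Longrightarrow> \<theta> 0 = 0 \<Longrightarrow> \<theta> \<circ> f \<in> cochains G T r"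
  by (simp add: cochains_def continuous_map_discrete_unop o_def)

lemma cochains_0: "(\<lambda>_. 0) \<in> cochains G T r"
  by (simp add: cochains_def)

lemma cochains_add: "f \<in> cochains G T r \<Longrightarrow> g \<in> cochains G T r \<Longrightarrow> (\<lambda>x. f x + g x) \<in> cochains G T r"
  by (rule cochains_binop) auto

lemma cochains_diff: "f \<in> cochains G T r \<Longrightarrow> g \<in> cochains G T r \<Longrightarrow> (\<lambda>x. f x - g x) \<in> cochains G T r"
  by (rule cochains_binop) auto

lemma cochains_signed: "f \<in> cochains G T r \<Longrightarrow> (\<lambda>x. signed n (f x)) \<in> cochains G T r"
  using cochains_comp[of f G T r "signed n"] by (simp add: o_def)

lemma cocycles_iff:
  "z \<in> cocycles G T act r \<longleftrightarrow> z \<in> cochains G T r \<and> coboundary G act r z = (\<lambda>_. 0)"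
  by (auto simp: cocycles_def kernel_def cochain_group_def)

lemma coboundary_comp:
  fixes \<theta> :: "'a::ab_group_add \<Rightarrow> 'b::ab_group_add"
  assumes "\<And>a b. \<theta> (a + b) = \<theta> a + \<theta> b"
    and "\<And>x a. x \<in> carrier G \<Longrightarrow> \<theta> (act x a) = act' x (\<theta> a)"
  shows "coboundary G act' r (\<theta> \<circ> f) = \<theta> \<circ> coboundary G act r f"
proof -
  interpret additive \<theta> by standard (rule assms)
  have "\<theta> (signed n a) = signed n (\<theta> a)" for n a
    by (rule diff_additive_signed) (rule diff)
  then show ?thesis
    by (auto simp: coboundary_def fun_eq_iff add diff sum zero assms(2) tuples_iff)
qed

context discrete_module
begin

lemma homogenize_add:
  assumes "\<sigma> \<in> lists (carrier G)" "\<sigma> \<noteq> []"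
  shows "homogenize G act (\<lambda>x. f x + f' x) \<sigma> = homogenize G act f \<sigma> + homogenize G act f' \<sigma>"
  using assms by (cases \<sigma>) (auto simp: homogenize_def act_add)

lemma homogenize_signed:
  assumes "\<sigma> \<in> lists (carrier G)" "\<sigma> \<noteq> []"
  shows "homogenize G act (\<lambda>x. signed n (f x)) \<sigma> = signed n (homogenize G act f \<sigma>)"
  using assms by (cases \<sigma>) (auto simp: homogenize_def act_signed)

lemma homogenize_zero:
  assumes "\<sigma> \<in> lists (carrier G)" "\<sigma> \<noteq> []"
  shows "homogenize G act (\<lambda>x. 0) \<sigma> = 0"
  using assms by (cases \<sigma>) (auto simp: homogenize_def act_0)

lemma coboundary_add:
  "coboundary G act r (\<lambda>x. f x + f' x) = (\<lambda>x. coboundary G act r f x + coboundary G act r f' x)"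
  by (auto simp: coboundary_def fun_eq_iff act_add signed_add sum.distrib tuples_iff algebra_simps)

lemma coboundary_diff:
  "coboundary G act r (\<lambda>x. f x - f' x) = (\<lambda>x. coboundary G act r f x - coboundary G act r f' x)"
  by (auto simp: coboundary_def fun_eq_iff act_diff signed_diff sum_subtractf tuples_iff algebra_simps)

lemma coboundary_zero: "coboundary G act r (\<lambda>x. 0) = (\<lambda>x. 0)"
  using coboundary_diff[of r "\<lambda>_. 0" "\<lambda>_. 0"] by simp

lemma coboundary_signed:
  "coboundary G act r (\<lambda>x. signed n (f x)) = (\<lambda>x. signed n (coboundary G act r f x))"
  using coboundary_diff[of r "\<lambda>_. 0" f] by (cases "even n") (auto simp: signed_def coboundary_zero)

text \<open>In this form the continuity of a coboundary follows from the continuity results for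
  vertex lists.\<close>

lemma coboundary_eq:
  "coboundary G act r f = inhomogenize G (Suc r) (simplicial_diff (homogenize G act f))"
proof
  fix x
  show "coboundary G act r f x = inhomogenize G (Suc r) (simplicial_diff (homogenize G act f)) x"
    using homogenize_coboundary[of "vertices G (Suc r) x" r f]
    by (cases "x \<in> tuples G (Suc r)")
      (simp_all add: homogenize_vertices vertices_in_lists inhomogenize_def coboundary_def[of _ _ _ _ x])
qed

lemma coboundary_vanish: "x \<notin> tuples G (Suc r) \<Longrightarrow> coboundary G act r f x = 0"
  by (simp add: coboundary_def)

lemma coboundary_coboundary: "coboundary G act (Suc r) (coboundary G act r f) = (\<lambda>_. 0)"
proof (rule homogenize_inject)
  fix \<sigma> assume \<sigma>: "\<sigma> \<in> lists (carrier G)" "length \<sigma> = Suc (Suc (Suc r))"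
  then have "homogenize G act (coboundary G act (Suc r) (coboundary G act r f)) \<sigma> =
      simplicial_diff (homogenize G act (coboundary G act r f)) \<sigma>"
    by (rule homogenize_coboundary)
  also have "\<dots> = simplicial_diff (simplicial_diff (homogenize G act f)) \<sigma>"
    using \<sigma> by (intro simplicial_diff_cong) (auto intro: homogenize_coboundary)
  finally show "homogenize G act (coboundary G act (Suc r) (coboundary G act r f)) \<sigma> =
      homogenize G act (\<lambda>_. 0) \<sigma>"
    using \<sigma> by (subst homogenize_zero) auto
qed (auto simp: coboundary_vanish)

lemma reverse_cochain_vanish: "x \<notin> tuples G r \<Longrightarrow> reverse_cochain G act r f x = 0"
  by (simp add: reverse_cochain_def inhomogenize_def)

lemma reverse_cochain_apply:
  "x \<in> tuples G r \<Longrightarrow> reverse_cochain G act r f x =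
     signed (\<Sum>{..<Suc r}) (homogenize G act f (rev (vertices G r x)))"
  by (simp add: reverse_cochain_def inhomogenize_def reversal_def del: sum.lessThan_Suc)

lemma reverse_cochain_add:
  "reverse_cochain G act r (\<lambda>x. f x + f' x) =
     (\<lambda>x. reverse_cochain G act r f x + reverse_cochain G act r f' x)"
proof
  fix x
  have "vertices G r x \<noteq> []"
    using length_vertices[of r x] by (metis length_greater_0_conv zero_less_Suc)
  then show "reverse_cochain G act r (\<lambda>x. f x + f' x) x =
      reverse_cochain G act r f x + reverse_cochain G act r f' x"
    using vertices_in_lists[of x r]
    by (cases "x \<in> tuples G r")
      (auto simp: reverse_cochain_vanish reverse_cochain_apply homogenize_add signed_add in_lists_conv_set
        simp del: sum.lessThan_Suc)
qed

lemma reverse_cochain_signed: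
  "reverse_cochain G act r (\<lambda>x. signed n (f x)) = (\<lambda>x. signed n (reverse_cochain G act r f x))"
proof
  fix x
  have "vertices G r x \<noteq> []"
    using length_vertices[of r x] by (metis length_greater_0_conv zero_less_Suc)
  then show "reverse_cochain G act r (\<lambda>x. signed n (f x)) x = signed n (reverse_cochain G act r f x)"
    using vertices_in_lists[of x r]
    by (cases "x \<in> tuples G r")
      (auto simp: reverse_cochain_vanish reverse_cochain_apply homogenize_signed signed_signed add.commute in_lists_conv_set
        simp del: sum.lessThan_Suc)
qed

lemma coboundary_reverse_cochain:
  "coboundary G act r (reverse_cochain G act r f) = reverse_cochain G act (Suc r) (coboundary G act r f)"
proof (rule homogenize_inject)
  fix \<sigma> assume \<sigma>: "\<sigma> \<in> lists (carrier G)" "length \<sigma> = Suc (Suc r)"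
  then have "homogenize G act (coboundary G act r (reverse_cochain G act r f)) \<sigma> =
      simplicial_diff (homogenize G act (reverse_cochain G act r f)) \<sigma>"
    by (rule homogenize_coboundary)
  also have "\<dots> = simplicial_diff (reversal (homogenize G act f)) \<sigma>"
    using \<sigma> by (intro simplicial_diff_cong) (auto intro: homogenize_reverse_cochain)
  also have "\<dots> = reversal (homogenize G act (coboundary G act r f)) \<sigma>"
    unfolding simplicial_diff_reversal reversal_def
    using \<sigma> homogenize_coboundary[of "rev \<sigma>" r f] by (simp add: in_lists_conv_set)
  also have "\<dots> = homogenize G act (reverse_cochain G act (Suc r) (coboundary G act r f)) \<sigma>"
    using \<sigma> by (rule homogenize_reverse_cochain[symmetric])
  finally show "homogenize G act (coboundary G act r (reverse_cochain G act r f)) \<sigma> =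
      homogenize G act (reverse_cochain G act (Suc r) (coboundary G act r f)) \<sigma>" .
qed (auto simp: coboundary_vanish reverse_cochain_vanish)

end

lemma (in group) reverse_cochain_comp:
  fixes \<theta> :: "'c::ab_group_add \<Rightarrow> 'd::ab_group_add"
  assumes \<theta>: "\<And>a b. \<theta> (a + b) = \<theta> a + \<theta> b"
    and act: "\<And>x a. x \<in> carrier G \<Longrightarrow> \<theta> (act x a) = act' x (\<theta> a)"
  shows "reverse_cochain G act' r (\<theta> \<circ> f) = \<theta> \<circ> reverse_cochain G act r f"
proof
  fix x
  have \<theta>': "\<theta> (a - b) = \<theta> a - \<theta> b" for a b
    by (rule additive_diff) (rule \<theta>)
  \<comment> \<open>The last vertex heads the reversed list, and \<open>\<theta>\<close> intertwines
    the actions only of elements of the carrier.\<close>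
  have "last (vertices G r x) \<in> carrier G" if "x \<in> tuples G r"
    using vertices_in_lists[OF that] length_vertices[of r x] by (cases "vertices G r x" rule: rev_cases) auto
  then show "reverse_cochain G act' r (\<theta> \<circ> f) x = (\<theta> \<circ> reverse_cochain G act r f) x"
    by (simp add: reverse_cochain_def inhomogenize_def reversal_def homogenize_def hd_rev act
        diff_additive_signed[of \<theta>, OF \<theta>'] diff_additive_0[of \<theta>, OF \<theta>'])
qed

section \<open>Cohomology classes and the effect of reversal on them\<close>

context profinite_module
begin

lemma coboundary_in_cochains: "f \<in> cochains G T r \<Longrightarrow> coboundary G act r f \<in> cochains G T (Suc r)"
  unfolding coboundary_eq
  by (intro inhomogenize_in_cochains continuous_on_lists_simplicial_diff continuous_on_lists_homogenize)

lemma reverse_cochain_in_cochains: "f \<in> cochains G T r \<Longrightarrow> reverse_cochain G act r f \<in> cochains G T r"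
  unfolding reverse_cochain_def
  by (intro inhomogenize_in_cochains continuous_on_lists_reversal continuous_on_lists_homogenize)

lemma coboundaries_subset: "coboundaries G T act r \<subseteq> cocycles G T act r"
  by (cases r) (auto simp: coboundaries_def cocycles_iff coboundary_in_cochains coboundary_coboundary
      coboundary_zero cochains_0)

lemma coboundariesI: "f \<in> cochains G T r \<Longrightarrow> coboundary G act r f \<in> coboundaries G T act (Suc r)"
  by (simp add: coboundaries_def)

lemma coboundaries_0: "(\<lambda>_. 0) \<in> coboundaries G T act r"
proof (cases r)
  case (Suc q)
  then show ?thesis
    using coboundariesI[OF cochains_0, of q] by (simp add: coboundary_zero)
qed (simp add: coboundaries_def)

lemma coboundaries_diff:
  assumes "b \<in> coboundaries G T act r" "b' \<in> coboundaries G T act r"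
  shows "(\<lambda>x. b x - b' x) \<in> coboundaries G T act r"
proof (cases r)
  case (Suc q)
  then obtain h h' where h: "h \<in> cochains G T q" "h' \<in> cochains G T q"
    and "b = coboundary G act q h" "b' = coboundary G act q h'"
    using assms by (auto simp: coboundaries_def)
  then have "(\<lambda>x. b x - b' x) = coboundary G act q (\<lambda>x. h x - h' x)"
    by (simp add: coboundary_diff)
  then show ?thesis
    using coboundariesI[OF cochains_diff[OF h]] Suc by simp
qed (use assms in \<open>auto simp: coboundaries_def\<close>)

lemma coboundaries_add:
  assumes "b \<in> coboundaries G T act r" "b' \<in> coboundaries G T act r"
  shows "(\<lambda>x. b x + b' x) \<in> coboundaries G T act r"
  using coboundaries_diff[OF assms(1) coboundaries_diff[OF coboundaries_0 assms(2)]] by simp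

lemma coboundaries_signed:
  "b \<in> coboundaries G T act r \<Longrightarrow> (\<lambda>x. signed n (b x)) \<in> coboundaries G T act r"
  using coboundaries_diff[OF coboundaries_0, of b r] by (cases "even n") (auto simp: signed_def)

lemma cohomology_class_eq_iff:
  "cohomology_class G T act r f = cohomology_class G T act r f' \<longleftrightarrow>
     (\<lambda>x. f x - f' x) \<in> coboundaries G T act r"
proof -
  have mem: "u \<in> cohomology_class G T act r f \<longleftrightarrow> (\<lambda>x. u x - f x) \<in> coboundaries G T act r"
    for u and f :: "(nat \<Rightarrow> 'g) \<Rightarrow> 'a"
    by (auto simp: cohomology_class_def r_coset_def cochain_group_def intro!: bexI[of _ "\<lambda>x. u x - f x"])
  show ?thesis
  proof
    assume "cohomology_class G T act r f = cohomology_class G T act r f'"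
    then show "(\<lambda>x. f x - f' x) \<in> coboundaries G T act r"
      using mem[of f f] mem[of f f'] by (simp add: coboundaries_0)
  next
    assume d: "(\<lambda>x. f x - f' x) \<in> coboundaries G T act r"
    have "(\<lambda>x. u x - f x) \<in> coboundaries G T act r \<longleftrightarrow> (\<lambda>x. u x - f' x) \<in> coboundaries G T act r" for u
      using coboundaries_add[OF _ d, of "\<lambda>x. u x - f x"] coboundaries_diff[OF _ d, of "\<lambda>x. u x - f' x"]
      by auto
    then show "cohomology_class G T act r f = cohomology_class G T act r f'"
      by (auto simp: mem)
  qed
qed

lemma carrier_cohomology:
  "carrier (cohomology G T act r) = cohomology_class G T act r ` cocycles G T act r"
  by (auto simp: cohomology_def FactGroup_def RCOSETS_def cohomology_class_def r_coset_def)

text \<open>This links the two forms of the sign, pointwise on cochains and as an integer power in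
  the multiplicatively written quotient group. It holds because taking classes is a group
  homomorphism.\<close>

lemma cohomology_class_signed:
  assumes "z \<in> cocycles G T act r"
  shows "cohomology_class G T act r (\<lambda>x. signed n (z x)) =
    cohomology_class G T act r z [^]\<^bsub>cohomology G T act r\<^esub> ((-1) ^ n :: int)"
proof -
  define Z where "Z = (cochain_group G T r)\<lparr>carrier := cocycles G T act r\<rparr>"
  have simps: "carrier Z = cocycles G T act r" "f \<otimes>\<^bsub>Z\<^esub> g = (\<lambda>x. f x + g x)" "\<one>\<^bsub>Z\<^esub> = (\<lambda>_. 0)" for f g
    by (simp_all add: Z_def cochain_group_def)
  have cl: "(\<lambda>_. 0) \<in> cocycles G T act r"
    "f \<in> cocycles G T act r \<Longrightarrow> g \<in> cocycles G T act r \<Longrightarrow> (\<lambda>x. f x + g x) \<in> cocycles G T act r"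
    "f \<in> cocycles G T act r \<Longrightarrow> (\<lambda>x. - f x) \<in> cocycles G T act r" for f g
    using cochains_signed[of f G T r 1] coboundary_signed[of r 1 f]
    by (auto simp: cocycles_iff cochains_0 cochains_add coboundary_add coboundary_zero signed_def)
  interpret Z: comm_group Z
    by (rule comm_groupI) (auto simp: simps cl algebra_simps intro!: bexI[of _ "\<lambda>x. - _ x"])
  have inv: "inv\<^bsub>Z\<^esub> f = (\<lambda>x. - f x)" if "f \<in> cocycles G T act r" for f
    by (rule Z.inv_equality) (use that cl in \<open>auto simp: simps\<close>)
  have "subgroup (coboundaries G T act r) Z"
    using coboundaries_subset coboundaries_0 coboundaries_add coboundaries_diff[OF coboundaries_0]
    by (intro subgroup.intro) (auto simp: simps inv subset_iff)
  then interpret N: normal "coboundaries G T act r" Z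
    by (rule Z.subgroup_imp_normal)
  interpret H: group "cohomology G T act r"
    using N.factorgroup_is_group by (simp add: cohomology_def Z_def)
  have class_eq: "cohomology_class G T act r f = coboundaries G T act r #>\<^bsub>Z\<^esub> f" for f
    by (simp add: cohomology_class_def r_coset_def Z_def)
  interpret hom: group_hom Z "cohomology G T act r" "cohomology_class G T act r"
    using N.r_coset_hom_Mod H.is_group
    by unfold_locales (auto simp: class_eq[abs_def] cohomology_def Z_def)
  show ?thesis
  proof (cases "even n")
    case True
    then show ?thesis using hom.hom_closed[of z] assms by (simp add: signed_def simps)
  next
    case False
    then show ?thesis
      using hom.hom_closed[of z] assms hom.hom_inv[of z] H.int_pow_neg[of "cohomology_class G T act r z" 1]
      by (simp add: signed_def simps inv)
  qed
qed

text \<open>For a cocycle the term K(dH) of the homotopy formula vanishes, leaving TH - H = d(KH).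
  Since KH is equivariant and continuous, it comes from a cochain one degree lower.\<close>

lemma reverse_cochain_cohomologous:
  assumes z: "z \<in> cocycles G T act r"
  shows "(\<lambda>x. reverse_cochain G act r z x - z x) \<in> coboundaries G T act r"
proof -
  let ?H = "homogenize G act z"
  have zero: "reversal_homotopy (Suc r) (simplicial_diff ?H) \<sigma> = 0"
    if "\<sigma> \<in> lists (carrier G)" "length \<sigma> = Suc r" for \<sigma>
  proof -
    \<comment> \<open>The differential of \<open>?H\<close> is known to vanish only on lists over
      the carrier, so it cannot be rewritten to the zero function; naturality with the zero map as
      \<open>\<theta>\<close> circumvents this.\<close>
    have "reversal_homotopy (Suc r) (simplicial_diff ?H) (map (\<lambda>a. a) \<sigma>) =
        (\<lambda>a. 0) (reversal_homotopy (Suc r) (\<lambda>_. 0) \<sigma>)"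
    proof (rule reversal_homotopy_map[OF _ that])
      fix \<tau> assume \<tau>: "\<tau> \<in> lists (carrier G)" "length \<tau> = Suc (Suc r)"
      then have "\<tau> \<noteq> []" by auto
      then show "simplicial_diff ?H (map (\<lambda>a. a) \<tau>) = 0"
        using homogenize_coboundary[OF \<tau>, of z] z \<tau> by (simp add: cocycles_iff homogenize_zero)
    qed simp
    then show ?thesis by simp
  qed
  have K: "simplicial_diff (reversal_homotopy r ?H) \<sigma> = reversal ?H \<sigma> - ?H \<sigma>"
    if "\<sigma> \<in> lists (carrier G)" "length \<sigma> = Suc r" for \<sigma>
    using reversal_homotopy[OF that(2), of ?H] zero[OF that] by (simp del: reversal_homotopy.simps(2))
  have zc: "z \<in> cochains G T r" using z by (simp add: cocycles_iff)
  have eq: "reverse_cochain G act r z x - z x =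
      simplicial_diff (reversal_homotopy r ?H) (vertices G r x)" if "x \<in> tuples G r" for x
    using K[of "vertices G r x"] that vertices_in_lists[OF that]
    by (simp add: reverse_cochain_def inhomogenize_def homogenize_vertices)
  have out: "reverse_cochain G act r z x - z x = 0" if "x \<notin> tuples G r" for x
    using that cochains_vanish[OF zc that] by (simp add: reverse_cochain_vanish)
  show ?thesis
  proof (cases r)
    \<comment> \<open>In degree 0 only zero is a coboundary, so equality is required; the homotopy
      with index 0 is zero by definition.\<close>
    case 0
    have "reverse_cochain G act r z x - z x = 0" for x
      using eq[of x] out[of x] 0 by (cases "x \<in> tuples G r") (auto simp: vertices_def)
    then show ?thesis by (simp add: coboundaries_0)
  next
    case (Suc q)
    \<comment> \<open>A cochain of degree \<open>q\<close> has \<open>Suc q = r\<close> vertices,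
      which is the index the homotopy expects.\<close>
    define h where "h = inhomogenize G q (reversal_homotopy r ?H)"
    have h: "h \<in> cochains G T q"
      unfolding h_def Suc
      by (intro inhomogenize_in_cochains continuous_on_lists_reversal_homotopy
          continuous_on_lists_homogenize) (use zc Suc in simp)
    have Hh: "homogenize G act h \<sigma> = reversal_homotopy r ?H \<sigma>"
      if "\<sigma> \<in> lists (carrier G)" "length \<sigma> = Suc q" for \<sigma>
      unfolding h_def
    proof (rule homogenize_inhomogenize[OF _ that])
      fix g \<sigma> assume g: "g \<in> carrier G" and \<sigma>: "\<sigma> \<in> lists (carrier G)" "length \<sigma> = Suc q"
      show "reversal_homotopy r ?H (map ((\<otimes>) g) \<sigma>) = act g (reversal_homotopy r ?H \<sigma>)"
      proof (rule reversal_homotopy_map[of "act g", OF act_diff[OF g] \<sigma>(1)])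
        show "length \<sigma> = r" using \<sigma> Suc by simp
        fix \<tau> assume \<tau>: "\<tau> \<in> lists (carrier G)" "length \<tau> = Suc r"
        then show "?H (map ((\<otimes>) g) \<tau>) = act g (?H \<tau>)"
          by (intro homogenize_equivariant g) auto
      qed
    qed
    have "reverse_cochain G act r z x - z x = coboundary G act q h x" for x
    proof (cases "x \<in> tuples G r")
      case True
      have "simplicial_diff (homogenize G act h) (vertices G r x) =
          simplicial_diff (reversal_homotopy r ?H) (vertices G r x)"
        using vertices_in_lists[OF True] by (intro simplicial_diff_cong) (auto simp: Suc intro!: Hh[unfolded Suc] simp del: reversal_homotopy.simps)
      then show ?thesis
        unfolding eq[OF True] coboundary_eq inhomogenize_def using True Suc by simp
    next
      case False
      then show ?thesis unfolding out[OF False] using Suc by (simp add: coboundary_vanish)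
    qed
    then show ?thesis
      using coboundariesI[OF h] Suc by simp
  qed
qed

end

section \<open>Cup products\<close>

context G_bilinear
begin

lemma diff_left: "pair (a - a') b = pair a b - pair a' b"
  by (rule additive_diff[of "\<lambda>a. pair a b"]) (rule add_left)

lemma diff_right: "pair a (b - b') = pair a b - pair a b'"
  by (rule additive_diff) (rule add_right)

lemma zero_left: "pair 0 b = 0"
  using diff_left[of 0 0] by simp

lemma zero_right: "pair a 0 = 0"
  using diff_right[of a 0 0] by simp

lemma G_bilinear_swap: "G_bilinear G T actB actA actC (\<lambda>b a. pair a b)"
  by (intro G_bilinear.intro G_bilinear_axioms.intro left.discrete_module_axioms
      right.discrete_module_axioms target.discrete_module_axioms)
     (simp_all add: add_left add_right equivariant)

lemma cup_vanish: "x \<notin> tuples G (r + s) \<Longrightarrow> cup G actB pair r s f g x = 0"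
  by (simp add: cup_def)

lemma cup_add_left:
  "cup G actB pair r s (\<lambda>x. f x + f' x) g = (\<lambda>x. cup G actB pair r s f g x + cup G actB pair r s f' g x)"
  by (auto simp: cup_def add_left)

lemma cup_zero_left: "cup G actB pair r s (\<lambda>_. 0) g = (\<lambda>_. 0)"
  by (auto simp: cup_def zero_left)

lemma cup_zero_right: "cup G actB pair r s f (\<lambda>_. 0) = (\<lambda>_. 0)"
proof -
  have "tuple_prod G r x \<in> carrier G" if "x \<in> tuples G (r + s)" for x
    using that by (intro left.tuple_prod_closed) (auto simp: tuples_iff)
  then show ?thesis
    by (auto simp: cup_def right.act_0 zero_right)
qed

lemma cup_eq:
  "cup G actB pair r s f g =
     inhomogenize G (r + s) (vertex_cup pair r (homogenize G actA f) (homogenize G actB g))"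
proof
  fix x
  show "cup G actB pair r s f g x =
      inhomogenize G (r + s) (vertex_cup pair r (homogenize G actA f) (homogenize G actB g)) x"
    using homogenize_cup[of "vertices G (r + s) x" r s f g]
    by (cases "x \<in> tuples G (r + s)")
      (simp_all add: target.homogenize_vertices left.vertices_in_lists inhomogenize_def cup_vanish)
qed

lemma coboundary_cup:
  "coboundary G actC (r + s) (cup G actB pair r s f g) =
     (\<lambda>x. cup G actB pair (Suc r) s (coboundary G actA r f) g x
          + signed r (cup G actB pair r (Suc s) f (coboundary G actB s g) x))"
    (is "?L = (\<lambda>x. ?A x + signed r (?B x))")
proof (rule target.homogenize_inject)
  fix \<sigma> assume \<sigma>: "\<sigma> \<in> lists (carrier G)" "length \<sigma> = Suc (Suc (r + s))"
  let ?F = "homogenize G actA f" and ?F' = "homogenize G actB g"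
  have "take (Suc (Suc r)) \<sigma> \<in> lists (carrier G)" "drop r \<sigma> \<in> lists (carrier G)"
    using \<sigma> by (auto dest: in_set_takeD in_set_dropD)
  then have d: "homogenize G actA (coboundary G actA r f) (take (Suc (Suc r)) \<sigma>) =
      simplicial_diff ?F (take (Suc (Suc r)) \<sigma>)"
    "homogenize G actB (coboundary G actB s g) (drop r \<sigma>) = simplicial_diff ?F' (drop r \<sigma>)"
    using \<sigma> by (auto intro!: left.homogenize_coboundary right.homogenize_coboundary)
  have "homogenize G actC ?L \<sigma> = simplicial_diff (homogenize G actC (cup G actB pair r s f g)) \<sigma>"
    using \<sigma> by (rule target.homogenize_coboundary)
  also have "\<dots> = simplicial_diff (vertex_cup pair r ?F ?F') \<sigma>"
    using \<sigma> by (intro simplicial_diff_cong) (auto intro!: homogenize_cup)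
  also have "\<dots> = vertex_cup pair (Suc r) (simplicial_diff ?F) ?F' \<sigma>
      + signed r (vertex_cup pair r ?F (simplicial_diff ?F') \<sigma>)"
    by (rule simplicial_diff_vertex_cup) (use \<sigma> in \<open>auto simp: diff_left diff_right\<close>)
  also have "\<dots> = homogenize G actC ?A \<sigma> + signed r (homogenize G actC ?B \<sigma>)"
    using \<sigma> by (simp add: homogenize_cup vertex_cup_def d)
  also have "\<dots> = homogenize G actC (\<lambda>x. ?A x + signed r (?B x)) \<sigma>"
  proof -
    have "\<sigma> \<noteq> []" using \<sigma> by auto
    then show ?thesis
      by (simp add: target.homogenize_add[OF \<sigma>(1)] target.homogenize_signed[OF \<sigma>(1)])
  qed
  finally show "homogenize G actC ?L \<sigma> = homogenize G actC (\<lambda>x. ?A x + signed r (?B x)) \<sigma>" .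
qed (auto simp: target.coboundary_vanish cup_vanish)

text \<open>Inhomogeneously even the module acted upon changes, from the second factor to the first.
  On vertex lists no action is visible and only the exchange of faces remains.\<close>

lemma reverse_cochain_cup:
  "reverse_cochain G actC (r + s) (cup G actB pair r s f g) =
     (\<lambda>x. signed (r * s) (cup G actA (\<lambda>b a. pair a b) s r
        (reverse_cochain G actB s g) (reverse_cochain G actA r f) x))"
    (is "?L = (\<lambda>x. signed _ (?R x))")
proof -
  interpret swap: G_bilinear G T actB actA actC "\<lambda>b a. pair a b"
    by (rule G_bilinear_swap)
  show ?thesis
  proof (rule target.homogenize_inject)
    fix \<sigma> assume \<sigma>: "\<sigma> \<in> lists (carrier G)" "length \<sigma> = Suc (r + s)"
    let ?F = "homogenize G actA f" and ?F' = "homogenize G actB g"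
    have "take (Suc s) \<sigma> \<in> lists (carrier G)" "drop s \<sigma> \<in> lists (carrier G)"
      using \<sigma> by (auto dest: in_set_takeD in_set_dropD)
    then have d: "homogenize G actA (reverse_cochain G actA r f) (drop s \<sigma>) = reversal ?F (drop s \<sigma>)"
      "homogenize G actB (reverse_cochain G actB s g) (take (Suc s) \<sigma>) = reversal ?F' (take (Suc s) \<sigma>)"
      using \<sigma> by (auto intro!: left.homogenize_reverse_cochain right.homogenize_reverse_cochain)
    have "homogenize G actC ?L \<sigma> = reversal (homogenize G actC (cup G actB pair r s f g)) \<sigma>"
      using \<sigma> by (rule target.homogenize_reverse_cochain)
    also have "\<dots> = reversal (vertex_cup pair r ?F ?F') \<sigma>"
      using \<sigma> homogenize_cup[of "rev \<sigma>" r s f g] by (simp add: reversal_def in_lists_conv_set)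
    also have "\<dots> = signed (r * s) (vertex_cup (\<lambda>b a. pair a b) s (reversal ?F') (reversal ?F) \<sigma>)"
      by (rule reversal_vertex_cup) (use \<sigma> in \<open>auto simp: diff_left diff_right\<close>)
    also have "\<dots> = signed (r * s) (homogenize G actC ?R \<sigma>)"
      using \<sigma> by (simp add: swap.homogenize_cup vertex_cup_def d)
    also have "\<dots> = homogenize G actC (\<lambda>x. signed (r * s) (?R x)) \<sigma>"
      using \<sigma> by (intro target.homogenize_signed[symmetric]) auto
    finally show "homogenize G actC ?L \<sigma> = homogenize G actC (\<lambda>x. signed (r * s) (?R x)) \<sigma>" .
  qed (auto simp: target.reverse_cochain_vanish swap.cup_vanish add.commute)
qed

end

lemma (in profinite_group) cup_in_cochains:
  fixes actA :: "'g \<Rightarrow> 'a::ab_group_add \<Rightarrow> 'a" and actB :: "'g \<Rightarrow> 'b::ab_group_add \<Rightarrow> 'b"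
    and actC :: "'g \<Rightarrow> 'c::ab_group_add \<Rightarrow> 'c"
  assumes "G_bilinear G T actA actB actC pair"
    and f: "f \<in> cochains G T r" and g: "g \<in> cochains G T s"
  shows "cup G actB pair r s f g \<in> cochains G T (r + s)"
proof -
  interpret G_bilinear G T actA actB actC pair by fact
  interpret A: profinite_module G T actA ..
  interpret B: profinite_module G T actB ..
  show ?thesis
    unfolding cup_eq
    by (intro inhomogenize_in_cochains continuous_on_lists_vertex_cup
        A.continuous_on_lists_homogenize B.continuous_on_lists_homogenize f g)
qed

section \<open>The augmented cup product\<close>

context short_exact_sequence
begin

lemma i_0: "i 0 = 0"
  using i_add[of 0 0] by simp

lemma j_0: "j 0 = 0"
  using j_add[of 0 0] by simp

lemma comp_i_inject: "i \<circ> f = i \<circ> f' \<longleftrightarrow> f = f'"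
  using i_inj by (auto simp: fun_eq_iff inj_eq)

lemma coboundary_comp_i: "coboundary G act r (i \<circ> f) = i \<circ> coboundary G act' r f"
  using i_add i_act by (rule coboundary_comp)

lemma coboundary_comp_j: "coboundary G act'' r (j \<circ> f) = j \<circ> coboundary G act r f"
  using j_add j_act by (rule coboundary_comp)

text \<open>The partial inverse of \<open>i\<close> is continuous because the modules are discrete,
  and it fixes 0, so vanishing off the tuples is preserved.\<close>

lemma factor_through_sub:
  assumes "f \<in> cochains G T r" "j \<circ> f = (\<lambda>_. 0)"
  obtains a where "a \<in> cochains G T r" "i \<circ> a = f"
proof
  have "f x \<in> range i" for x
    using assms(2) exact by (simp add: fun_eq_iff)
  then show "i \<circ> (the_inv i \<circ> f) = f"
    using f_the_inv_into_f[OF i_inj] by (auto simp: fun_eq_iff)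
  have "the_inv i 0 = 0"
    using the_inv_f_f[OF i_inj, of 0] by (simp add: i_0)
  then show "the_inv i \<circ> f \<in> cochains G T r"
    using assms(1) by (rule cochains_comp[rotated])
qed

text \<open>Any set-theoretic section of \<open>j\<close> is continuous for discrete modules. It is
  altered to send 0 to 0 so that the lift still vanishes off the tuples.\<close>

lemma lift_cochain:
  assumes "f \<in> cochains G T r"
  obtains h where "h \<in> cochains G T r" "j \<circ> h = f"
proof
  let ?s = "\<lambda>u. if u = 0 then 0 else inv_into UNIV j u"
  show "?s \<circ> f \<in> cochains G T r"
    using assms by (rule cochains_comp) simp
  show "j \<circ> (?s \<circ> f) = f"
    using surj_f_inv_f[OF j_surj] by (auto simp: fun_eq_iff j_0)
qed

definition lifted_cocycles :: "nat \<Rightarrow> ((nat \<Rightarrow> 'g) \<Rightarrow> 'a) set" where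
  "lifted_cocycles r = {f \<in> cochains G T r. j \<circ> f \<in> cocycles G T act'' r}"

text \<open>The cochain \<open>a\<close> represents the image of the class of
  \<open>j \<circ> f\<close> under the connecting homomorphism. It is a cocycle since dd = 0 and
  \<open>i\<close> is injective.\<close>

lemma lifted_cocycles_coboundary:
  assumes "f \<in> lifted_cocycles r" "profinite_group G T"
  obtains a where "a \<in> cochains G T (Suc r)" "i \<circ> a = coboundary G act r f"
    "coboundary G act' (Suc r) a = (\<lambda>_. 0)"
proof -
  interpret profinite_group G T by fact
  interpret M: profinite_module G T act ..
  have "coboundary G act r f \<in> cochains G T (Suc r)"
    using assms(1) by (intro M.coboundary_in_cochains) (simp add: lifted_cocycles_def)
  moreover have "j \<circ> coboundary G act r f = (\<lambda>_. 0)"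
    using assms(1) by (simp add: lifted_cocycles_def cocycles_iff flip: coboundary_comp_j)
  ultimately obtain a where a: "a \<in> cochains G T (Suc r)" "i \<circ> a = coboundary G act r f"
    by (rule factor_through_sub)
  have "i \<circ> coboundary G act' (Suc r) a = i \<circ> (\<lambda>_. 0)"
    unfolding coboundary_comp_i[symmetric] a(2) mid.coboundary_coboundary by (simp add: fun_eq_iff i_0)
  then show ?thesis
    using that[OF a] by (simp only: comp_i_inject)
qed

text \<open>Reversal commutes with \<open>j\<close>, and on the quotient it does not change
  cohomology classes. The reversed lift is thus another admissible choice for the same
  class.\<close>

lemma reverse_lifted_cocycle:
  assumes "f \<in> lifted_cocycles r" "profinite_group G T"
  shows "reverse_cochain G act r f \<in> lifted_cocycles r"
    and "cohomology_class G T act'' r (j \<circ> reverse_cochain G act r f) =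
      cohomology_class G T act'' r (j \<circ> f)"
proof -
  interpret profinite_group G T by fact
  interpret M: profinite_module G T act ..
  interpret Q: profinite_module G T act'' ..
  have eq: "j \<circ> reverse_cochain G act r f = reverse_cochain G act'' r (j \<circ> f)"
    using sub.reverse_cochain_comp[of j act act'' r f] j_add j_act by simp
  have z: "j \<circ> f \<in> cocycles G T act'' r" and f: "f \<in> cochains G T r"
    using assms(1) by (simp_all add: lifted_cocycles_def)
  from Q.reverse_cochain_cohomologous[OF z]
  show class_eq: "cohomology_class G T act'' r (j \<circ> reverse_cochain G act r f) =
      cohomology_class G T act'' r (j \<circ> f)"
    unfolding Q.cohomology_class_eq_iff eq by (simp add: o_def)
  have "coboundary G act'' r (reverse_cochain G act'' r (j \<circ> f)) =
      reverse_cochain G act'' (Suc r) (\<lambda>_. 0)"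
    using z by (simp add: quot.coboundary_reverse_cochain cocycles_iff)
  also have "\<dots> = (\<lambda>_. 0)"
    using quot.reverse_cochain_add[of "Suc r" "\<lambda>_. 0" "\<lambda>_. 0"] by (simp add: fun_eq_iff)
  finally show "reverse_cochain G act r f \<in> lifted_cocycles r"
    using f z M.reverse_cochain_in_cochains[OF f] Q.reverse_cochain_in_cochains
    by (auto simp: lifted_cocycles_def eq cocycles_iff)
qed

text \<open>Lifting to the middle module a cochain that bounds the difference in the quotient leaves
  a remainder killed by \<open>j\<close>, hence coming from the submodule. Degree 0 has no such
  cochain and is a case of its own.\<close>

lemma lifted_cocycles_cohomologous:
  assumes "f \<in> cochains G T r" "f' \<in> cochains G T r" "profinite_group G T"
    and "cohomology_class G T act'' r (j \<circ> f) = cohomology_class G T act'' r (j \<circ> f')"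
  obtains (0) a where "r = 0" "a \<in> cochains G T r" "f = (\<lambda>x. f' x + i (a x))"
  | (Suc) q h a where "r = Suc q" "h \<in> cochains G T q" "a \<in> cochains G T r"
      "f = (\<lambda>x. (f' x + i (a x)) + coboundary G act q h x)"
proof -
  interpret profinite_group G T by fact
  interpret M: profinite_module G T act ..
  interpret Q: profinite_module G T act'' ..
  have j_diff: "j (u - v) = j u - j v" for u v
    by (rule additive_diff) (rule j_add)
  have d: "(\<lambda>x. j (f x) - j (f' x)) \<in> coboundaries G T act'' r"
    using assms(4) by (simp add: Q.cohomology_class_eq_iff)
  show ?thesis
  proof (cases r)
    case r: 0
    have "j \<circ> (\<lambda>x. f x - f' x) = (\<lambda>_. 0)"
      using d by (simp add: r coboundaries_def fun_eq_iff j_diff)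
    then obtain a where a: "a \<in> cochains G T r" "i \<circ> a = (\<lambda>x. f x - f' x)"
      by (rule factor_through_sub[OF cochains_diff[OF assms(1,2)]])
    then have "f = (\<lambda>x. f' x + i (a x))" by (simp add: fun_eq_iff)
    then show ?thesis using a r that(1) by blast
  next
    case r: (Suc q)
    obtain h'' where h'': "h'' \<in> cochains G T q" "(\<lambda>x. j (f x) - j (f' x)) = coboundary G act'' q h''"
      using d by (auto simp: r coboundaries_def)
    obtain h where h: "h \<in> cochains G T q" "j \<circ> h = h''"
      using lift_cochain[OF h''(1)] .
    have dh: "coboundary G act q h \<in> cochains G T r"
      unfolding r by (rule M.coboundary_in_cochains[OF h(1)])
    have "j (coboundary G act q h x) = j (f x) - j (f' x)" for x
      using coboundary_comp_j[of q h] h''(2) h(2) by (simp add: fun_eq_iff)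
    then have "j \<circ> (\<lambda>x. f x - f' x - coboundary G act q h x) = (\<lambda>_. 0)"
      by (simp add: fun_eq_iff j_diff)
    then obtain a where a: "a \<in> cochains G T r" "i \<circ> a = (\<lambda>x. f x - f' x - coboundary G act q h x)"
      by (rule factor_through_sub[OF cochains_diff[OF cochains_diff[OF assms(1,2)] dh]])
    then have "f = (\<lambda>x. (f' x + i (a x)) + coboundary G act q h x)"
      by (simp add: fun_eq_iff)
    then show ?thesis using a h r that(2) by blast
  qed
qed

end

section \<open>Tate products over a profinite group\<close>

locale profinite_tate_product = profinite_group G T + tate_product G T P
  for G :: "('g, 'm) monoid_scheme" (structure) and T :: "'g topology"
    and P :: "('g, 'a1::ab_group_add, 'a::ab_group_add, 'a2::ab_group_add,
               'b1::ab_group_add, 'b::ab_group_add, 'b2::ab_group_add, 'c::ab_group_add) tate_data"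
begin

sublocale C: profinite_module G T "actC P" ..

lemma aug_cochain_eq:
  assumes "iA P \<circ> a = coboundary G (actA P) r f" "iB P \<circ> b = coboundary G (actB P) s g"
  shows "aug_cochain G P r s f g =
    (\<lambda>x. cup G (actB P) (pairA' P) (Suc r) s a g x + signed r (cup G (actB' P) (pairB' P) r (Suc s) f b x))"
proof -
  have "the_inv (iA P) \<circ> coboundary G (actA P) r f = a" "the_inv (iB P) \<circ> coboundary G (actB P) s g = b"
    unfolding assms[symmetric] using sesA.i_inj sesB.i_inj by (auto simp: the_inv_f_f)
  then show ?thesis
    by (intro ext) (simp only: aug_cochain_def)
qed

text \<open>This is the agreement of the two pairings carried to cochains; equivariance of
  \<open>iB P\<close> moves it past the action in the second factor.\<close>

lemma cup_coincide:
  "cup G (actB P) (pairA' P) r s a (iB P \<circ> b) = cup G (actB' P) (pairB' P) r s (iA P \<circ> a) b"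
proof -
  have "tuple_prod G r x \<in> carrier G" if "x \<in> tuples G (r + s)" for x
    using that by (intro tuple_prod_closed) (auto simp: tuples_iff)
  then show ?thesis
    by (auto simp: cup_def pairs_coincide simp flip: sesB.i_act)
qed

text \<open>Since \<open>a\<close> and \<open>b\<close> are cocycles, the Leibniz rule leaves
  (-1)^(r+1) a \<union> dg and (-1)^r df \<union> b, which cancel because dg =
  \<open>iB P \<circ> b\<close>, df = \<open>iA P \<circ> a\<close> and the pairings
  coincide.\<close>

lemma aug_cochain_in_cocycles:
  assumes f: "f \<in> sesA.lifted_cocycles r" and g: "g \<in> sesB.lifted_cocycles s"
  shows "aug_cochain G P r s f g \<in> cocycles G T (actC P) (r + s + 1)"
proof -
  obtain a where a: "a \<in> cochains G T (Suc r)" "iA P \<circ> a = coboundary G (actA P) r f"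
    "coboundary G (actA' P) (Suc r) a = (\<lambda>_. 0)"
    using sesA.lifted_cocycles_coboundary[OF f profinite_group_axioms] .
  obtain b where b: "b \<in> cochains G T (Suc s)" "iB P \<circ> b = coboundary G (actB P) s g"
    "coboundary G (actB' P) (Suc s) b = (\<lambda>_. 0)"
    using sesB.lifted_cocycles_coboundary[OF g profinite_group_axioms] .
  let ?U = "cup G (actB P) (pairA' P) (Suc r) s a g" and ?V = "cup G (actB' P) (pairB' P) r (Suc s) f b"
  have "?U \<in> cochains G T (Suc r + s)" "?V \<in> cochains G T (r + Suc s)"
    using f g a b by (auto intro!: cup_in_cochains[OF bilA'.G_bilinear_axioms]
      cup_in_cochains[OF bilB'.G_bilinear_axioms] simp: sesA.lifted_cocycles_def sesB.lifted_cocycles_def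
      simp del: add_Suc add_Suc_right)
  then have "(\<lambda>x. ?U x + signed r (?V x)) \<in> cochains G T (Suc (r + s))"
    by (intro cochains_add cochains_signed) simp_all
  moreover have "coboundary G (actC P) (Suc (r + s)) (\<lambda>x. ?U x + signed r (?V x)) = (\<lambda>_. 0)"
    using bilA'.coboundary_cup[of "Suc r" s a g] bilB'.coboundary_cup[of r "Suc s" f b]
    by (simp add: modC.coboundary_add modC.coboundary_signed a b bilA'.cup_zero_left bilB'.cup_zero_right
        cup_coincide flip: a(2) b(2))
  ultimately show ?thesis
    by (simp add: cocycles_iff aug_cochain_eq[OF a(2) b(2)])
qed

text \<open>Two lifts differ by i(c) + dh, the dh occurring in positive degree only. The first part
  changes the augmented cochain by d(c \<union> g), the second by (-1)^r d(h \<union> b).\<close>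

lemma aug_cochain_cohomologous_left:
  assumes f: "f \<in> sesA.lifted_cocycles r" and f': "f' \<in> sesA.lifted_cocycles r"
    and g: "g \<in> sesB.lifted_cocycles s"
    and class_eq: "cohomology_class G T (actA'' P) r (jA P \<circ> f) = cohomology_class G T (actA'' P) r (jA P \<circ> f')"
  shows "cohomology_class G T (actC P) (r + s + 1) (aug_cochain G P r s f g) =
    cohomology_class G T (actC P) (r + s + 1) (aug_cochain G P r s f' g)"
proof -
  obtain a where a: "a \<in> cochains G T (Suc r)" "iA P \<circ> a = coboundary G (actA P) r f'"
    "coboundary G (actA' P) (Suc r) a = (\<lambda>_. 0)"
    using sesA.lifted_cocycles_coboundary[OF f' profinite_group_axioms] .
  obtain b where b: "b \<in> cochains G T (Suc s)" "iB P \<circ> b = coboundary G (actB P) s g"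
    "coboundary G (actB' P) (Suc s) b = (\<lambda>_. 0)"
    using sesB.lifted_cocycles_coboundary[OF g profinite_group_axioms] .
  have cochains: "f \<in> cochains G T r" "f' \<in> cochains G T r" "g \<in> cochains G T s"
    using f f' g by (simp_all add: sesA.lifted_cocycles_def sesB.lifted_cocycles_def)
  let ?cupA = "cup G (actB P) (pairA' P)" and ?cupB = "cup G (actB' P) (pairB' P)"
  \<comment> \<open>This is the Leibniz rule for c \<union> g, with c \<union> dg rewritten as i(c)
    \<union> b.\<close>
  have sub: "(\<lambda>x. ?cupA (Suc r) s (coboundary G (actA' P) r c) g x +
      signed r (?cupB r (Suc s) (iA P \<circ> c) b x)) \<in> coboundaries G T (actC P) (r + s + 1)"
    if c: "c \<in> cochains G T r" for c
    using C.coboundariesI[OF cup_in_cochains[OF bilA'.G_bilinear_axioms c cochains(3)]]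
    by (simp add: bilA'.coboundary_cup cup_coincide flip: b(2))
  have diff: "(\<lambda>x. (?cupA (Suc r) s a' g x + signed r (?cupB r (Suc s) f b x)) -
      (?cupA (Suc r) s a g x + signed r (?cupB r (Suc s) f' b x))) \<in> coboundaries G T (actC P) (r + s + 1)
      \<Longrightarrow> iA P \<circ> a' = coboundary G (actA P) r f \<Longrightarrow> ?thesis" for a'
    using aug_cochain_eq[OF _ b(2)] a(2) by (simp add: C.cohomology_class_eq_iff)
  \<comment> \<open>Adding i(c) to the lift adds dc to its connecting cocycle.\<close>
  have shifted: "iA P \<circ> (\<lambda>x. a x + coboundary G (actA' P) r c x) =
      coboundary G (actA P) r (\<lambda>x. f' x + iA P (c x))" for c
    using sesA.coboundary_comp_i[of r c] a(2)
    by (simp add: sesA.mid.coboundary_add fun_eq_iff sesA.i_add o_def)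
  from cochains(1,2) profinite_group_axioms class_eq show ?thesis
  proof (cases rule: sesA.lifted_cocycles_cohomologous)
    case (0 c)
    show ?thesis
      by (rule diff[OF _ shifted[of c, folded 0(3)]])
        (use sub[OF 0(2)] in \<open>simp add: 0(3) bilA'.cup_add_left bilB'.cup_add_left signed_add o_def algebra_simps\<close>)
  next
    case (Suc q h c)
    have h: "coboundary G (actA P) r (coboundary G (actA P) q h) = (\<lambda>_. 0)"
      unfolding Suc(1) by (rule sesA.mid.coboundary_coboundary)
    \<comment> \<open>Since \<open>b\<close> is a cocycle, dh \<union> b is d(h \<union> b). Adding
      dh to the lift leaves its coboundary, and hence the other summand, unchanged.\<close>
    have "(\<lambda>x. ?cupB r (Suc s) (coboundary G (actA P) q h) b x) \<in> coboundaries G T (actC P) (r + s + 1)"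
      using C.coboundariesI[OF cup_in_cochains[OF bilB'.G_bilinear_axioms Suc(2) b(1)]]
      using bilB'.coboundary_cup[of q "Suc s" h b]
      by (simp add: b(3) bilB'.cup_zero_right Suc(1))
    from C.coboundaries_add[OF sub[OF Suc(3)] C.coboundaries_signed[OF this, of r]]
    show ?thesis
      by - (rule diff[of "\<lambda>x. a x + coboundary G (actA' P) r c x"],
        simp add: Suc(4) bilA'.cup_add_left bilB'.cup_add_left signed_add o_def algebra_simps,
        simp add: Suc(4) shifted sesA.mid.coboundary_add h)
  qed
qed

lemma flip_profinite_tate_product: "profinite_tate_product G T (flip P)"
proof -
  interpret A: G_bilinear G T "actB P" "actA' P" "actC P" "\<lambda>b a'. pairA' P a' b"
    by (rule bilA'.G_bilinear_swap)
  interpret B: G_bilinear G T "actB' P" "actA P" "actC P" "\<lambda>b' a. pairB' P a b'"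
    by (rule bilB'.G_bilinear_swap)
  show ?thesis
    by (intro profinite_tate_product.intro tate_product.intro tate_product_axioms.intro;
      simp add: flip_def profinite_group_axioms sesA.short_exact_sequence_axioms
        sesB.short_exact_sequence_axioms modC.discrete_module_axioms A.G_bilinear_axioms
        B.G_bilinear_axioms pairs_coincide)
qed

text \<open>The equality is exact. Reversing a \<union> g gives the sign (-1)^((r+1)s) = (-1)^(rs)
  (-1)^s, whose last factor is the one in the flipped augmented cochain; reversing (-1)^r f \<union>
  b gives (-1)^(r + r(s+1)) = (-1)^(rs). So the two summands change places with the common sign
  (-1)^(rs).\<close>

lemma reverse_aug_cochain:
  assumes f: "f \<in> sesA.lifted_cocycles r" and g: "g \<in> sesB.lifted_cocycles s"
  shows "reverse_cochain G (actC P) (r + s + 1) (aug_cochain G P r s f g) =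
    (\<lambda>x. signed (r * s) (aug_cochain G (flip P) s r
      (reverse_cochain G (actB P) s g) (reverse_cochain G (actA P) r f) x))"
proof -
  interpret F: profinite_tate_product G T "flip P"
    by (rule flip_profinite_tate_product)
  obtain a where a: "a \<in> cochains G T (Suc r)" "iA P \<circ> a = coboundary G (actA P) r f"
    "coboundary G (actA' P) (Suc r) a = (\<lambda>_. 0)"
    using sesA.lifted_cocycles_coboundary[OF f profinite_group_axioms] .
  obtain b where b: "b \<in> cochains G T (Suc s)" "iB P \<circ> b = coboundary G (actB P) s g"
    "coboundary G (actB' P) (Suc s) b = (\<lambda>_. 0)"
    using sesB.lifted_cocycles_coboundary[OF g profinite_group_axioms] .
  have Ta: "iA P \<circ> reverse_cochain G (actA' P) (Suc r) a =
      coboundary G (actA P) r (reverse_cochain G (actA P) r f)"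
    unfolding sesA.mid.coboundary_reverse_cochain a(2)[symmetric]
    by (rule reverse_cochain_comp[symmetric]) (auto simp: sesA.i_add sesA.i_act)
  have Tb: "iB P \<circ> reverse_cochain G (actB' P) (Suc s) b =
      coboundary G (actB P) s (reverse_cochain G (actB P) s g)"
    unfolding sesB.mid.coboundary_reverse_cochain b(2)[symmetric]
    by (rule reverse_cochain_comp[symmetric]) (auto simp: sesB.i_add sesB.i_act)
  have "aug_cochain G (flip P) s r (reverse_cochain G (actB P) s g) (reverse_cochain G (actA P) r f) =
    (\<lambda>x. cup G (actA P) (\<lambda>b' a. pairB' P a b') (Suc s) r (reverse_cochain G (actB' P) (Suc s) b)
          (reverse_cochain G (actA P) r f) x
      + signed s (cup G (actA' P) (\<lambda>b a'. pairA' P a' b) s (Suc r) (reverse_cochain G (actB P) s g)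
          (reverse_cochain G (actA' P) (Suc r) a) x))"
    using F.aug_cochain_eq[of "reverse_cochain G (actB' P) (Suc s) b" s "reverse_cochain G (actB P) s g"
        "reverse_cochain G (actA' P) (Suc r) a" r "reverse_cochain G (actA P) r f"] Ta Tb
    by (simp add: flip_def)
  then show ?thesis
    using bilA'.reverse_cochain_cup[of "Suc r" s a g] bilB'.reverse_cochain_cup[of r "Suc s" f b]
    by (simp add: aug_cochain_eq[OF a(2) b(2)] modC.reverse_cochain_add modC.reverse_cochain_signed
        signed_add signed_signed fun_eq_iff) (simp add: signed_def)
qed

lemma class_aug_cochain_flip:
  assumes f: "f \<in> sesA.lifted_cocycles r" and g: "g \<in> sesB.lifted_cocycles s"
  shows "cohomology_class G T (actC P) (r + s + 1) (aug_cochain G P r s f g) =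
    cohomology_class G T (actC P) (r + s + 1) (\<lambda>x. signed (r * s) (aug_cochain G (flip P) s r
      (reverse_cochain G (actB P) s g) (reverse_cochain G (actA P) r f) x))"
  unfolding reverse_aug_cochain[OF assms, symmetric]
  using C.reverse_cochain_cohomologous[OF aug_cochain_in_cocycles[OF assms]]
  by (rule C.cohomology_class_eq_iff[THEN iffD2, symmetric])

lemma aug_cochain_cohomologous_right:
  assumes f: "f \<in> sesA.lifted_cocycles r"
    and g: "g \<in> sesB.lifted_cocycles s" and g': "g' \<in> sesB.lifted_cocycles s"
    and class_eq: "cohomology_class G T (actB'' P) s (jB P \<circ> g) = cohomology_class G T (actB'' P) s (jB P \<circ> g')"
  shows "cohomology_class G T (actC P) (r + s + 1) (aug_cochain G P r s f g) =
    cohomology_class G T (actC P) (r + s + 1) (aug_cochain G P r s f g')"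
proof -
  interpret F: profinite_tate_product G T "flip P"
    by (rule flip_profinite_tate_product)
  note Tf = sesA.reverse_lifted_cocycle[OF f profinite_group_axioms]
  note Tg = sesB.reverse_lifted_cocycle[OF g profinite_group_axioms]
    and Tg' = sesB.reverse_lifted_cocycle[OF g' profinite_group_axioms]
  let ?F = "reverse_cochain G (actA P) r f"
  let ?w = "aug_cochain G (flip P) s r (reverse_cochain G (actB P) s g) ?F"
  let ?w' = "aug_cochain G (flip P) s r (reverse_cochain G (actB P) s g') ?F"
  have "cohomology_class G T (actC P) (r + s + 1) ?w = cohomology_class G T (actC P) (r + s + 1) ?w'"
    using F.aug_cochain_cohomologous_left[of "reverse_cochain G (actB P) s g" s
        "reverse_cochain G (actB P) s g'" ?F r] Tf Tg Tg' class_eq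
    by (simp add: flip_def add.commute)
  then have "(\<lambda>x. signed (r * s) (?w x - ?w' x)) \<in> coboundaries G T (actC P) (r + s + 1)"
    by (intro C.coboundaries_signed) (simp add: C.cohomology_class_eq_iff)
  then show ?thesis
    unfolding class_aug_cochain_flip[OF f g] class_aug_cochain_flip[OF f g']
    by (simp only: C.cohomology_class_eq_iff signed_diff)
qed

text \<open>The definite description is resolved by changing one representative at a time: the first
  lift while the second is kept, then the second.\<close>

lemma aug_cup_eq:
  assumes f: "f \<in> sesA.lifted_cocycles r" and g: "g \<in> sesB.lifted_cocycles s"
  shows "aug_cup G T P r s (cohomology_class G T (actA'' P) r (jA P \<circ> f))
      (cohomology_class G T (actB'' P) s (jB P \<circ> g)) =
    cohomology_class G T (actC P) (r + s + 1) (aug_cochain G P r s f g)"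
  unfolding aug_cup_def
proof (rule the_equality, goal_cases)
  case 1
  show ?case
    using f g by (auto simp: sesA.lifted_cocycles_def sesB.lifted_cocycles_def)
next
  case (2 \<gamma>)
  then obtain f' g' where f': "f' \<in> sesA.lifted_cocycles r" and g': "g' \<in> sesB.lifted_cocycles s"
    and eq: "cohomology_class G T (actA'' P) r (jA P \<circ> f') = cohomology_class G T (actA'' P) r (jA P \<circ> f)"
      "cohomology_class G T (actB'' P) s (jB P \<circ> g') = cohomology_class G T (actB'' P) s (jB P \<circ> g)"
    and \<gamma>: "\<gamma> = cohomology_class G T (actC P) (r + s + 1) (aug_cochain G P r s f' g')"
    by (auto simp: sesA.lifted_cocycles_def sesB.lifted_cocycles_def)
  show ?case
    unfolding \<gamma> aug_cochain_cohomologous_left[OF f' f g' eq(1)]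
    by (rule aug_cochain_cohomologous_right[OF f g' g eq(2)])
qed

text \<open>The flipped product is evaluated on the reversed lifts instead of the original ones.
  They represent the same classes, and for them the comparison of cochains is already
  available.\<close>

lemma aug_cup_flip:
  assumes "\<alpha> \<in> carrier (cohomology G T (actA'' P) r)" "\<beta> \<in> carrier (cohomology G T (actB'' P) s)"
  shows "aug_cup G T P r s \<alpha> \<beta> =
    aug_cup G T (flip P) s r \<beta> \<alpha> [^]\<^bsub>cohomology G T (actC P) (r + s + 1)\<^esub> ((- 1) ^ (r * s) :: int)"
proof -
  interpret F: profinite_tate_product G T "flip P"
    by (rule flip_profinite_tate_product)
  interpret A'': profinite_module G T "actA'' P" ..
  interpret B'': profinite_module G T "actB'' P" ..
  obtain z where z: "z \<in> cocycles G T (actA'' P) r" "\<alpha> = cohomology_class G T (actA'' P) r z"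
    using assms(1) by (auto simp: A''.carrier_cohomology)
  then obtain f where f: "f \<in> cochains G T r" "jA P \<circ> f = z"
    using sesA.lift_cochain[of z r] by (auto simp: cocycles_iff)
  obtain z' where z': "z' \<in> cocycles G T (actB'' P) s" "\<beta> = cohomology_class G T (actB'' P) s z'"
    using assms(2) by (auto simp: B''.carrier_cohomology)
  then obtain g where g: "g \<in> cochains G T s" "jB P \<circ> g = z'"
    using sesB.lift_cochain[of z' s] by (auto simp: cocycles_iff)
  have fg: "f \<in> sesA.lifted_cocycles r" "g \<in> sesB.lifted_cocycles s"
    using f g z z' by (simp_all add: sesA.lifted_cocycles_def sesB.lifted_cocycles_def)
  note Tf = sesA.reverse_lifted_cocycle[OF fg(1) profinite_group_axioms]
    and Tg = sesB.reverse_lifted_cocycle[OF fg(2) profinite_group_axioms]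
  let ?w = "aug_cochain G (flip P) s r (reverse_cochain G (actB P) s g) (reverse_cochain G (actA P) r f)"
  have w: "?w \<in> cocycles G T (actC P) (r + s + 1)"
    using F.aug_cochain_in_cocycles[of "reverse_cochain G (actB P) s g" s
        "reverse_cochain G (actA P) r f" r] Tf(1) Tg(1)
    by (simp add: flip_def add.commute)
  have "aug_cup G T (flip P) s r \<beta> \<alpha> = cohomology_class G T (actC P) (r + s + 1) ?w"
    using F.aug_cup_eq[of "reverse_cochain G (actB P) s g" s "reverse_cochain G (actA P) r f" r] Tf Tg
    by (simp add: flip_def add.commute f g z z')
  moreover have "aug_cup G T P r s \<alpha> \<beta> =
      cohomology_class G T (actC P) (r + s + 1) (\<lambda>x. signed (r * s) (?w x))"
    using aug_cup_eq[OF fg] class_aug_cochain_flip[OF fg] by (simp add: f g z z')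
  ultimately show ?thesis
    by (simp only: C.cohomology_class_signed[OF w])
qed

end

theorem proposition4p1:
  fixes G :: "('g, 'm) monoid_scheme" and T :: "'g topology"
    and P :: "('g, 'a1::ab_group_add, 'a::ab_group_add, 'a2::ab_group_add,
               'b1::ab_group_add, 'b::ab_group_add, 'b2::ab_group_add, 'c::ab_group_add) tate_data"
    and r s :: nat
    and \<alpha> :: "((nat \<Rightarrow> 'g) \<Rightarrow> 'a2) set" and \<beta> :: "((nat \<Rightarrow> 'g) \<Rightarrow> 'b2) set"
  assumes "profinite_group G T"
    and "tate_product G T P"
    and "\<alpha> \<in> carrier (cohomology G T (actA'' P) r)"
    and "\<beta> \<in> carrier (cohomology G T (actB'' P) s)"
  shows "aug_cup G T P r s \<alpha> \<beta> =
         aug_cup G T (flip P) s r \<beta> \<alpha>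
           [^]\<^bsub>cohomology G T (actC P) (r + s + 1)\<^esub> ((- 1) ^ (r * s) :: int)"
  using profinite_tate_product.aug_cup_flip[OF profinite_tate_product.intro[OF assms(1,2)] assms(3,4)] .

end
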